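(* Let $\mathbb{F}_q$ be a finite field of characteristic $p$ with $q=p^d$ elements, $q\neq 2,3,5$. Let $(\mathbb{T},\mathfrak{m}_\mathbb{T})$ be a finite-dimensional local commutative $\mathbb{F}_q$-algebra with the discrete topology and residue field $\mathbb{T}/\mathfrak{m}_\mathbb{T}\simeq\mathbb{F}_q$, and suppose $\mathfrak{m}_\mathbb{T}^2=0$. Let $\Gamma$ be a profinite group and $\rho:\Gamma\to\mathrm{GL}_2(\mathbb{T})$ a continuous representation such that (a) $\mathrm{Im}(\overline{\rho})=\mathrm{GL}_2^D(\mathbb{F}_q)$, where $\overline{\rho}$ is the reduction of $\rho$ modulo $\mathfrak{m}_\mathbb{T}$ and $D:=\mathrm{Im}(\det\circ\overline{\rho})$; (b) $\mathrm{Im}(\rho)\subseteq\mathrm{GL}_2^D(\mathbb{T})$; (c) $\mathbb{T}$ is generated as an $\mathbb{F}_q$-algebra by the traces of $\rho$. Let $m:=\dim_{\mathbb{F}_q}\mathfrak{m}_\mathbb{T}$ and let $t$ be the number of distinct traces of elements of $\mathrm{Im}(\rho)$. If $p\neq 2$, then $t=q^{m+1}$ and $$\mathrm{Im}(\rho)\simeq(\underbrace{\mathrm{M}_2^0(\mathbb{F}_q)\oplus\cdots\oplus\mathrm{M}_2^0(\mathbb{F}_q)}_{m})\rtimes\mathrm{GL}_2^D(\mathbb{F}_q)\simeq\mathrm{GL}_2^D(\mathbb{T}).$$ If $p=2$, then $t=q^\alpha\cdot((q-1)2^\beta+1)$ for some $0\leq\alpha\leq m$ and $0\leq\beta\leq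 d(m-\alpha)$, and $\mathrm{Im}(\rho)\simeq M\rtimes\mathrm{GL}_2^D(\mathbb{F}_q)$, where $M$ is an $\mathbb{F}_2[\mathrm{GL}_2^D(\mathbb{F}_q)]$-submodule of $\mathrm{M}_2^0(\mathfrak{m}_\mathbb{T})$ of the form $$M\simeq\underbrace{\mathrm{M}_2^0(\mathbb{F}_q)\oplus\cdots\oplus\mathrm{M}_2^0(\mathbb{F}_q)}_{\alpha}\oplus\underbrace{C_2\oplus\cdots\oplus C_2}_{\beta},$$ with $C_2$ a subgroup of order $2$ of the scalar matrices. Moreover, $M$ is determined uniquely by $t$ up to isomorphism.
   Context: $\mathrm{GL}_2^D(R)$ denotes $\{g\in\mathrm{GL}_2(R):\det g\in D\}$ for $R=\mathbb{F}_q$ or $\mathbb{T}$ (with $D\subseteq\mathbb{F}_q^\times\subseteq\mathbb{T}^\times$). $\mathrm{M}_2^0(X)$ denotes the trace-zero $2\times 2$ matrices with entries in $X$; $\mathrm{M}_2^0(\mathfrak{m}_\mathbb{T})$ is identified with the kernel of $\mathrm{GL}_2^D(\mathbb{T})\to\mathrm{GL}_2^D(\mathbb{F}_q)$ via $X\mapsto 1+X$, and $\mathrm{GL}_2^D(\mathbb{F}_q)$ acts on it (and on $\mathrm{M}_2^0(\mathbb{F}_q)$) by conjugation. Scalar matrices means $\{\lambda\mathrm{Id}_2:\lambda\in\mathbb{F}_q\}\subseteq\mathrm{M}_2^0(\mathbb{F}_q)$ (in characteristic $2$). *)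

theory Defs
  imports
    "HOL-Analysis.Analysis"
    "HOL-Algebra.Algebraic_Closure_Type"
    "HOL-Algebra.Product_Groups"
    "HOL-Algebra.Ideal_Product"
begin

text \<open>Coefficient rings are types, so that the library's matrices, determinants and traces
  apply; \<open>ring_of_type_algebra\<close> turns such a type into a HOL-Algebra ring (needed for ideals
  and quotients). Groups are HOL-Algebra groups.\<close>

locale profinite_group = group \<Gamma>
  for \<Gamma> :: "('g, 'x) monoid_scheme" (structure) and \<tau> :: "'g topology" +
  assumes topspace_eq: "topspace \<tau> = carrier \<Gamma>"
    and continuous_mult: "continuous_map (prod_topology \<tau> \<tau>) \<tau> (\<lambda>(x, y). x \<otimes> y)"
    and continuous_inv: "continuous_map \<tau> \<tau> (\<lambda>x. inv x)"
    and compact: "compact_space \<tau>"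
    and Hausdorff: "Hausdorff_space \<tau>"
    and totally_disconnected: "\<And>S. connectedin \<tau> S \<Longrightarrow> \<exists>a. S \<subseteq> {a}"

locale finite_dim_algebra = vector_space smul
  for smul :: "'k::field \<Rightarrow> 't::comm_ring_1 \<Rightarrow> 't" +
  assumes smul_mult: "smul a x * y = smul a (x * y)"
    and finite_dim: "\<exists>B. finite_dimensional_vector_space smul B"

text \<open>The local algebra \<open>(T, m)\<close>, where \<open>\<theta>\<close> is the isomorphism of \<open>k\<close>-algebras from \<open>T/m\<close>
  to \<open>k\<close>.\<close>

locale local_algebra = finite_dim_algebra smul
  for smul :: "'k::field \<Rightarrow> 't::comm_ring_1 \<Rightarrow> 't" +
  fixes mT :: "'t set" and \<theta> :: "'t set \<Rightarrow> 'k"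
  assumes maximal: "maximalideal mT (ring_of_type_algebra :: 't ring)"
    and unique_maximal: "\<And>J. maximalideal J (ring_of_type_algebra :: 't ring) \<Longrightarrow> J = mT"
    and residue_iso:
      "\<theta> \<in> ring_iso ((ring_of_type_algebra :: 't ring) Quot mT) (ring_of_type_algebra :: 'k ring)"
    and residue_iso_linear:
      "\<theta> (mT +>\<^bsub>(ring_of_type_algebra :: 't ring)\<^esub> smul a 1) = a"

definition residue_map :: "'t::comm_ring_1 set \<Rightarrow> ('t set \<Rightarrow> 'k) \<Rightarrow> 't \<Rightarrow> 'k" where
  "residue_map mT \<theta> x = \<theta> (mT +>\<^bsub>(ring_of_type_algebra :: 't ring)\<^esub> x)"

text \<open>The embedding of \<open>k\<close> into a \<open>k\<close>-algebra.\<close>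

definition emb :: "('k \<Rightarrow> 't::comm_ring_1 \<Rightarrow> 't) \<Rightarrow> 'k \<Rightarrow> 't" where
  "emb smul a = smul a 1"

definition is_subalgebra :: "('k \<Rightarrow> 't::comm_ring_1 \<Rightarrow> 't) \<Rightarrow> 't set \<Rightarrow> bool" where
  "is_subalgebra smul S \<longleftrightarrow>
     1 \<in> S \<and> (\<forall>x\<in>S. \<forall>y\<in>S. x + y \<in> S \<and> x * y \<in> S) \<and> (\<forall>a. \<forall>x\<in>S. smul a x \<in> S)"


text \<open>\<open>GL2 D\<close> is the group \<open>GL\<^sub>2\<^sup>D\<close>; in particular \<open>GL2 UNIV\<close> is \<open>GL\<^sub>2\<close>.\<close>

definition GL2 :: "'a::comm_ring_1 set \<Rightarrow> ('a^2^2) monoid" where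
  "GL2 D = \<lparr>carrier = {g. invertible g \<and> det g \<in> D}, monoid.mult = (**), one = mat 1\<rparr>"

definition conj_mat :: "'a::comm_ring_1^2^2 \<Rightarrow> 'a^2^2 \<Rightarrow> 'a^2^2" where
  "conj_mat g A = g ** A ** matrix_inv g"

text \<open>The additive group of trace-zero matrices with entries in \<open>S\<close>.\<close>

definition M20 :: "'a::comm_ring_1 set \<Rightarrow> ('a^2^2) monoid" where
  "M20 S = \<lparr>carrier = {A. trace A = 0 \<and> (\<forall>i j. A $ i $ j \<in> S)}, monoid.mult = (+), one = 0\<rparr>"

definition semidirect ::
  "('n, 'x) monoid_scheme \<Rightarrow> ('h, 'y) monoid_scheme \<Rightarrow> ('h \<Rightarrow> 'n \<Rightarrow> 'n) \<Rightarrow> ('n \<times> 'h) monoid" where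
  "semidirect N H act =
     \<lparr>carrier = carrier N \<times> carrier H,
      monoid.mult = (\<lambda>(n, h) (n', h'). (n \<otimes>\<^bsub>N\<^esub> act h n', h \<otimes>\<^bsub>H\<^esub> h')),
      one = (\<one>\<^bsub>N\<^esub>, \<one>\<^bsub>H\<^esub>)\<rparr>"

text \<open>Groups with an action of \<open>G\<close> by automorphisms. For elementary abelian 2-groups these are
  precisely the modules over the group algebra of \<open>G\<close> over the field with two elements: linearity
  over that field is automatic, so submodules are the \<open>G\<close>-stable subgroups and module isomorphisms
  are the \<open>G\<close>-equivariant group isomorphisms.\<close>

definition gmodule_iso ::
  "('h, 'y) monoid_scheme \<Rightarrow> ('m, 'x) monoid_scheme \<Rightarrow> ('h \<Rightarrow> 'm \<Rightarrow> 'm)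
     \<Rightarrow> ('n, 'z) monoid_scheme \<Rightarrow> ('h \<Rightarrow> 'n \<Rightarrow> 'n) \<Rightarrow> bool" where
  "gmodule_iso G M act N act' \<longleftrightarrow>
     (\<exists>f \<in> iso M N. \<forall>g \<in> carrier G. \<forall>x \<in> carrier M. f (act g x) = act' g (f x))"

definition gsubmodule ::
  "('h, 'y) monoid_scheme \<Rightarrow> ('m, 'x) monoid_scheme \<Rightarrow> ('h \<Rightarrow> 'm \<Rightarrow> 'm) \<Rightarrow> 'm set \<Rightarrow> bool" where
  "gsubmodule G N act M \<longleftrightarrow>
     subgroup M N \<and> (\<forall>g \<in> carrier G. \<forall>x \<in> M. act g x \<in> M)"

text \<open>Direct sums are taken in \<open>product_group {..<n}\<close>, whose elements are functions that are
  undefined outside \<open>{..<n}\<close>; hence the restriction in the componentwise action.\<close>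

definition conj_tuple :: "nat \<Rightarrow> 'a::comm_ring_1^2^2 \<Rightarrow> (nat \<Rightarrow> 'a^2^2) \<Rightarrow> nat \<Rightarrow> 'a^2^2" where
  "conj_tuple n g x = (\<lambda>i\<in>{..<n}. conj_mat g (x i))"

definition M20_pow :: "nat \<Rightarrow> (nat \<Rightarrow> 'k::comm_ring_1^2^2) monoid" where
  "M20_pow n = product_group {..<n} (\<lambda>_. M20 UNIV)"

definition mixed_module ::
  "nat \<Rightarrow> nat \<Rightarrow> ('k::comm_ring_1^2^2) set \<Rightarrow> ((nat \<Rightarrow> 'k^2^2) \<times> (nat \<Rightarrow> 'k^2^2)) monoid" where
  "mixed_module \<alpha> \<beta> C =
     M20_pow \<alpha> \<times>\<times> product_group {..<\<beta>} (\<lambda>_. (M20 UNIV)\<lparr>carrier := C\<rparr>)"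

definition mixed_act ::
  "nat \<Rightarrow> nat \<Rightarrow> 'k::comm_ring_1^2^2 \<Rightarrow> (nat \<Rightarrow> 'k^2^2) \<times> (nat \<Rightarrow> 'k^2^2)
     \<Rightarrow> (nat \<Rightarrow> 'k^2^2) \<times> (nat \<Rightarrow> 'k^2^2)" where
  "mixed_act \<alpha> \<beta> g = (\<lambda>(x, y). (conj_tuple \<alpha> g x, conj_tuple \<beta> g y))"

text \<open>The action of \<open>GL\<^sub>2(k)\<close> on trace-zero matrices over a \<open>k\<close>-algebra.\<close>

definition emb_conj ::
  "('k::comm_ring_1 \<Rightarrow> 't::comm_ring_1 \<Rightarrow> 't) \<Rightarrow> 'k^2^2 \<Rightarrow> 't^2^2 \<Rightarrow> 't^2^2" where
  "emb_conj smul g = conj_mat (map_matrix (emb smul) g)"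


definition residual_rep ::
  "'t::comm_ring_1 set \<Rightarrow> ('t set \<Rightarrow> 'k) \<Rightarrow> ('g \<Rightarrow> 't^2^2) \<Rightarrow> 'g \<Rightarrow> 'k^2^2" where
  "residual_rep mT \<theta> \<rho> g = map_matrix (residue_map mT \<theta>) (\<rho> g)"

locale full_image_rep =
  local_algebra smul mT \<theta> + profinite_group \<Gamma> \<tau>
  for smul :: "'k::{field,finite} \<Rightarrow> 't::comm_ring_1 \<Rightarrow> 't"
    and mT :: "'t set" and \<theta> :: "'t set \<Rightarrow> 'k"
    and \<Gamma> :: "'g monoid" and \<tau> :: "'g topology" +
  fixes \<rho> :: "'g \<Rightarrow> 't^2^2" and D :: "'k set"
  assumes square_zero: "mT \<cdot>\<^bsub>(ring_of_type_algebra :: 't ring)\<^esub> mT = {0}"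
    and rep_hom: "\<rho> \<in> hom \<Gamma> (GL2 UNIV)"
    and rep_continuous: "continuous_map \<tau> (discrete_topology (carrier (GL2 UNIV))) \<rho>"
    and D_eq: "D = (\<lambda>g. det (residual_rep mT \<theta> \<rho> g)) ` carrier \<Gamma>"
    and residual_image: "residual_rep mT \<theta> \<rho> ` carrier \<Gamma> = carrier (GL2 D)"
    and image_subset: "\<rho> ` carrier \<Gamma> \<subseteq> carrier (GL2 (emb smul ` D))"
    and traces_generate:
      "is_subalgebra smul hull ((\<lambda>g. trace (\<rho> g)) ` carrier \<Gamma>) = UNIV"

definition rep_image :: "'g monoid \<Rightarrow> ('g \<Rightarrow> 't::comm_ring_1^2^2) \<Rightarrow> ('t^2^2) monoid" where
  "rep_image \<Gamma> \<rho> = (GL2 UNIV)\<lparr>carrier := \<rho> ` carrier \<Gamma>\<rparr>"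

definition num_traces :: "'g monoid \<Rightarrow> ('g \<Rightarrow> 't::comm_ring_1^2^2) \<Rightarrow> nat" where
  "num_traces \<Gamma> \<rho> = card (trace ` carrier (rep_image \<Gamma> \<rho>))"

text \<open>The description of the image of \<open>\<rho>\<close> in characteristic 2 by \<open>(\<alpha>, \<beta>, M)\<close>, where the ground
  field has \<open>2 ^ d\<close> elements.\<close>

definition describes_image ::
  "('k::{field,finite} \<Rightarrow> 't::comm_ring_1 \<Rightarrow> 't) \<Rightarrow> 't set \<Rightarrow> 'g monoid \<Rightarrow> ('g \<Rightarrow> 't^2^2) \<Rightarrow> 'k set
     \<Rightarrow> nat \<Rightarrow> nat \<Rightarrow> nat \<Rightarrow> ('t^2^2) set \<Rightarrow> bool" where
  "describes_image smul mT \<Gamma> \<rho> D d \<alpha> \<beta> M \<longleftrightarrow>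
     \<alpha> \<le> vector_space.dim smul mT \<and>
     \<beta> \<le> d * (vector_space.dim smul mT - \<alpha>) \<and>
     num_traces \<Gamma> \<rho> = CARD('k) ^ \<alpha> * ((CARD('k) - 1) * 2 ^ \<beta> + 1) \<and>
     gsubmodule (GL2 D) (M20 mT) (emb_conj smul) M \<and>
     (\<exists>C. subgroup C (M20 (UNIV :: 'k set)) \<and> C \<subseteq> range mat \<and> card C = 2 \<and>
        gmodule_iso (GL2 D) ((M20 mT)\<lparr>carrier := M\<rparr>) (emb_conj smul)
          (mixed_module \<alpha> \<beta> C) (mixed_act \<alpha> \<beta>)) \<and>
     rep_image \<Gamma> \<rho> \<cong> semidirect ((M20 mT)\<lparr>carrier := M\<rparr>) (GL2 D) (emb_conj smul)"

end

theory Submission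
  imports Defs
begin

text \<open>
  Write \<open>A\<close> for the image of the representation. Since the maximal ideal \<open>m\<close> squares to zero, the
  condition \<open>(1 + X) g \<in> A\<close> defines a 1-cocycle of \<open>GL\<^sub>2\<^sup>D(k)\<close> with values in the quotient of
  \<open>M\<^sub>2\<^sup>0(m)\<close> by the kernel \<open>M = {X. 1 + X \<in> A}\<close>. Conjugating with the diagonal torus, the unipotents
  and the Weyl element shows that \<open>M\<close> consists of the trace-zero matrices with off-diagonal entries
  in a \<open>k\<close>-subspace \<open>W\<close> and diagonal entries in an additive group \<open>V\<close> with \<open>W \<subseteq> V\<close> and
  \<open>2 V \<subseteq> W\<close>. Evaluating the cocycle on the torus, then on the unipotents, then on the Weyl element
  shows that it is the coboundary of a matrix \<open>E\<close> over \<open>m\<close> (of arbitrary trace, which matters in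
  characteristic 2), so \<open>A\<close> splits. The traces are the elements \<open>s + s v + w\<close> with \<open>s \<in> k\<close>,
  \<open>v \<in> V\<close> and \<open>w \<in> W\<close>, hence there are \<open>|W| + (q - 1) |V|\<close> of them. If \<open>p\<close> is odd then \<open>V = W\<close>, and
  as the traces generate \<open>T\<close> this forces \<open>W = m\<close>. If \<open>p = 2\<close> then \<open>\<alpha> = dim W\<close> and \<open>|V / W| = 2\<^sup>\<beta>\<close>, and the
  number of traces determines \<open>\<alpha>\<close> and \<open>\<beta>\<close> because its odd part is 1 only for \<open>\<beta> = 0\<close>.
\<close>

(* otherwise matrix indexing is ambiguous with the coefficients of formal power series *)
no_notation fps_nth (infixl \<open>$\<close> 75)

section \<open>Two-by-two matrices\<close>

text \<open>The bounds on q come from the torus. Conjugation by diag(a, 1/a) fixes the diagonal of a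
  trace-zero matrix and scales its off-diagonal entries by a^2 and a^-2. Separating these entries
  from the diagonal takes an a with a^2 \<noteq> 1, hence q > 3. Separating them from each other
  takes a^4 \<noteq> 1, hence q > 5 in odd characteristic; in characteristic 2 the relation that
  unipotents are involutions does this work. The two cases of the result differ because of scalars.
  In odd characteristic a unipotent moves diag(h, -h) off the diagonal, which ties \<open>V\<close>
  to \<open>W\<close>. In characteristic 2 such a matrix is scalar and fixed by conjugation, so
  \<open>V\<close> is merely an additive group above \<open>W\<close>. Scalars also explain the
  trace of \<open>E\<close>. On unipotents the cocycle can be normalized to an upper right entry x
  \<delta>. In characteristic 2, with \<delta> outside \<open>W\<close>, this is not the coboundary
  of any trace-zero matrix, but it is one of diag(-\<delta>, 0). A coboundary of a matrix over m
  amounts to a conjugation in GL_2(T), which changes neither the isomorphism type of the image nor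
  its traces.\<close>

definition mat2 :: "'a::zero \<Rightarrow> 'a \<Rightarrow> 'a \<Rightarrow> 'a \<Rightarrow> 'a^2^2" where
  "mat2 a b c d = vector [vector [a, b], vector [c, d]]"

lemma mat2_nth [simp]:
  "mat2 a b c d $ 1 $ 1 = a" "mat2 a b c d $ 1 $ 2 = b"
  "mat2 a b c d $ 2 $ 1 = c" "mat2 a b c d $ 2 $ 2 = d"
  by (simp_all add: mat2_def)

lemma mat_eq_iff_2:
  "A = B \<longleftrightarrow> A $ 1 $ 1 = B $ 1 $ 1 \<and> A $ 1 $ 2 = B $ 1 $ 2 \<and>
     A $ 2 $ 1 = B $ 2 $ 1 \<and> A $ 2 $ 2 = (B::'a^2^2) $ 2 $ 2"
  unfolding vec_eq_iff forall_2 by blast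

lemma mat2_eta: "A = mat2 (A $ 1 $ 1) (A $ 1 $ 2) (A $ 2 $ 1) (A $ 2 $ 2)"
  by (simp add: mat_eq_iff_2)

lemma mat2_eq_iff [simp]: "mat2 a b c d = mat2 a' b' c' d' \<longleftrightarrow> a = a' \<and> b = b' \<and> c = c' \<and> d = d'"
  by (simp add: mat_eq_iff_2)

lemma mat2_mult [simp]:
  "mat2 a b c d ** mat2 a' b' c' d' =
     mat2 (a * a' + b * c') (a * b' + b * d') (c * a' + d * c') (c * b' + d * (d'::'a::semiring_1))"
  by (simp add: mat_eq_iff_2 matrix_matrix_mult_def sum_2)

lemma mat2_add [simp]: "mat2 a b c d + mat2 a' b' c' d' =
   mat2 (a + a') (b + b') (c + c') (d + (d'::'a::monoid_add))"
  by (simp add: mat_eq_iff_2)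

lemma mat2_diff [simp]: "mat2 a b c d - mat2 a' b' c' d' =
   mat2 (a - a') (b - b') (c - c') (d - (d'::'a::group_add))"
  by (simp add: mat_eq_iff_2)

lemma mat2_uminus [simp]: "- mat2 a b c d = mat2 (- a) (- b) (- c) (- (d::'a::group_add))"
  by (simp add: mat_eq_iff_2)

lemma mat_conv_mat2: "mat a = mat2 a 0 0 a"
  by (simp add: mat_eq_iff_2 mat_def)

lemma zero_conv_mat2: "0 = mat2 0 0 0 0"
  by (simp add: mat_eq_iff_2)

lemma trace_mat2 [simp]: "trace (mat2 a b c d) = a + d"
  by (simp add: trace_def sum_2)

lemma det_mat2 [simp]: "det (mat2 a b c d) = a * d - b * c"
  by (simp add: det_2)

lemma map_matrix_mat2 [simp]: "map_matrix f (mat2 a b c d) = mat2 (f a) (f b) (f c) (f d)"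
  by (simp add: mat_eq_iff_2)

lemma matrix_inv_eqI:
  fixes A :: "'a::semiring_1^'n^'n"
  assumes "A ** B = mat 1" "B ** A = mat 1"
  shows "matrix_inv A = B"
proof -
  have *: "A ** matrix_inv A = mat 1 \<and> matrix_inv A ** A = mat 1"
    unfolding matrix_inv_def by (rule someI[of _ B]) (use assms in blast)
  have "matrix_inv A = matrix_inv A ** (A ** B)"
    by (simp add: assms)
  also have "\<dots> = (matrix_inv A ** A) ** B"
    by (simp add: matrix_mul_assoc)
  finally show ?thesis
    using * by simp
qed

lemma conj_mat_eqI:
  assumes "g ** g' = mat 1" "g' ** g = mat 1"
  shows "conj_mat g A = g ** A ** g'"
  by (simp add: conj_mat_def matrix_inv_eqI[OF assms])

lemma invertible_matrix_inv:
  assumes "invertible (A::'a::semiring_1^'n^'n)"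
  shows "A ** matrix_inv A = mat 1" "matrix_inv A ** A = mat 1"
  using assms by (auto simp: invertible_def matrix_inv_eqI)

lemma matrix_add_rdistrib:
  "(A + B) ** C = A ** C + B ** (C :: 'a::semiring_1^'n^'m)"
  by (simp add: vec_eq_iff matrix_matrix_mult_def distrib_right sum.distrib)

lemma conj_mat_add: "conj_mat g (A + B) = conj_mat g A + conj_mat g B"
  by (simp add: conj_mat_def matrix_add_ldistrib matrix_add_rdistrib)

lemma matrix_diff_left: "(A - B) ** C = A ** C - B ** (C::'a::comm_ring_1^2^2)"
  and matrix_diff_right: "A ** (B - C) = A ** B - A ** (C::'a::comm_ring_1^2^2)"
  by (simp_all add: mat_eq_iff_2 matrix_matrix_mult_def sum_2 algebra_simps)

lemma conj_mat_zero [simp]: "conj_mat g 0 = 0"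
  by (simp add: conj_mat_def)

lemma conj_mat_diff: "conj_mat g (A - B) = conj_mat g A - conj_mat g B"
  by (simp add: conj_mat_def matrix_diff_left matrix_diff_right)

lemma conj_mat_one [simp]: "conj_mat (mat 1) A = A"
  by (simp add: conj_mat_def matrix_inv_eqI[of "mat 1" "mat 1"])

lemma conj_mat_mult:
  assumes "invertible g" "invertible h"
  shows "conj_mat (g ** h) A = conj_mat g (conj_mat h A)"
proof -
  let ?g = "matrix_inv g" and ?h = "matrix_inv h"
  have "(g ** h) ** (?h ** ?g) = g ** (h ** ?h) ** ?g" "(?h ** ?g) ** (g ** h) = ?h ** (?g ** g) ** h"
    by (simp_all only: matrix_mul_assoc)
  then have "conj_mat (g ** h) A = (g ** h) ** A ** (?h ** ?g)"
    by (intro conj_mat_eqI) (simp_all add: invertible_matrix_inv assms)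
  then show ?thesis
    by (simp add: conj_mat_def matrix_mul_assoc)
qed

lemma trace_mult_commute: "trace (A ** B) = trace (B ** (A::'a::comm_ring_1^2^2))"
  by (simp add: trace_def matrix_matrix_mult_def sum_2 algebra_simps)

lemma trace_conj_mat: "invertible g \<Longrightarrow> trace (conj_mat g A) = trace (A::'a::comm_ring_1^2^2)"
  unfolding conj_mat_def
  by (subst trace_mult_commute) (simp add: matrix_mul_assoc invertible_matrix_inv)

lemma conj_mat_scalar:
  assumes "invertible g"
  shows "conj_mat g (mat a) = (mat a :: 'a::comm_ring_1^2^2)"
proof -
  have "g ** mat a = mat a ** g"
    by (simp add: mat_eq_iff_2 matrix_matrix_mult_def sum_2 mat_def mult.commute)
  then show ?thesis
    by (simp add: conj_mat_def matrix_mul_assoc[symmetric] invertible_matrix_inv assms)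
qed

lemma GL2_carrier_field: "g \<in> carrier (GL2 D) \<longleftrightarrow> det g \<noteq> 0 \<and> det g \<in> (D::'a::field set)"
  by (simp add: GL2_def invertible_det_nz)

lemma GL2_simps [simp]:
  "monoid.mult (GL2 D) = (**)" "one (GL2 D) = mat 1"
  by (simp_all add: GL2_def)

lemma M20_simps [simp]:
  "monoid.mult (M20 S) = (+)" "one (M20 S) = 0"
  by (simp_all add: M20_def)

lemma M20_carrier: "A \<in> carrier (M20 S) \<longleftrightarrow> trace A = 0 \<and> (\<forall>i j. A $ i $ j \<in> S)"
  by (simp add: M20_def)

lemma M20_carrier_mat2:
  "mat2 a b c d \<in> carrier (M20 S) \<longleftrightarrow> a + d = 0 \<and> a \<in> S \<and> b \<in> S \<and> c \<in> S \<and> d \<in> S"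
  by (auto simp: M20_carrier forall_2)

section \<open>Finite fields\<close>

text \<open>Multiplication by \<open>x\<close> permutes the nonzero elements, so their product
  absorbs the factor \<open>x ^ (CARD('k) - 1)\<close>.\<close>

lemma finite_field_power_card_minus_1:
  fixes x :: "'k::{field,finite}"
  assumes "x \<noteq> 0"
  shows "x ^ (CARD('k) - 1) = 1"
proof -
  have "(\<Prod>y\<in>UNIV-{0}. x * y) = (\<Prod>y\<in>UNIV-{0}. y)"
    by (rule prod.reindex_bij_witness[of _ "\<lambda>y. y / x" "\<lambda>y. x * y"]) (use assms in auto)
  then have "x ^ (CARD('k) - 1) * \<Prod>(UNIV-{0}) = \<Prod>(UNIV-{0})"
    by (simp add: prod.distrib)
  then show ?thesis
    by (simp add: prod_zero_iff)
qed

lemma card_gt_3_obtains_square_neq_1: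
  assumes "CARD('k::{field,finite}) > 3"
  obtains a :: "'k::{field,finite}" where "a \<noteq> 0" "a ^ 2 \<noteq> 1"
proof -
  have "card {0, 1, -1 :: 'k} \<le> 3"
    by (intro order_trans[OF card_insert_le_m1]) auto
  then have "\<exists>a::'k. a \<notin> {0, 1, -1}"
    using assms by (metis UNIV_eq_I not_less)
  then show ?thesis
    using that by (auto simp: power2_eq_1_iff)
qed

text \<open>The polynomial X^4 - 1 has at most four roots, and 0 is a fifth element to avoid. The
  exponent 4 is the quotient of the torus weights a^2 and a^-2.\<close>

lemma card_gt_5_obtains_fourth_power_neq_1:
  assumes "CARD('k::{field,finite}) > 5"
  obtains a :: "'k::{field,finite}" where "a \<noteq> 0" "a ^ 4 \<noteq> 1"
proof -
  let ?p = "Polynomial.monom (1::'k) 4 - 1"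
  have c: "Polynomial.coeff ?p 4 = 1"
    by (simp add: Polynomial.coeff_1)
  then have "?p \<noteq> 0"
    by (metis Polynomial.coeff_0 zero_neq_one)
  then have "card {x. poly ?p x = 0} \<le> Polynomial.degree ?p"
    by (rule card_poly_roots_bound)
  also have "\<dots> \<le> 4"
    by (intro Polynomial.degree_diff_le) (simp_all add: Polynomial.degree_monom_le)
  finally have "card {x::'k. x ^ 4 = 1} \<le> 4"
    by (simp add: Polynomial.poly_monom)
  then have "card (insert 0 {x::'k. x ^ 4 = 1}) \<le> 5"
    by (intro order_trans[OF card_insert_le_m1]) auto
  then have "\<exists>a::'k. a \<notin> insert 0 {x. x ^ 4 = 1}"
    using assms by (metis UNIV_eq_I not_less)
  then show ?thesis
    using that by auto
qed

text \<open>Rescaling the summation variable by some \<open>b\<close> multiplies the sum by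
  \<open>b ^ 2\<close>, which can be chosen different from 1.\<close>

lemma sum_nonzero_squares_eq_0:
  assumes "CARD('k::{field,finite}) > 3"
  shows "(\<Sum>a\<in>UNIV-{0::'k::{field,finite}}. a ^ 2) = 0"
    "(\<Sum>a\<in>UNIV-{0::'k}. inverse a ^ 2) = 0"
proof -
  obtain b :: 'k where b: "b \<noteq> 0" "b ^ 2 \<noteq> 1"
    using card_gt_3_obtains_square_neq_1 assms by blast
  have "(\<Sum>a\<in>UNIV-{0::'k}. a ^ 2) = (\<Sum>a\<in>UNIV-{0::'k}. (b * a) ^ 2)"
    by (rule sum.reindex_bij_witness[of _ "\<lambda>y. b * y" "\<lambda>y. y / b"]) (use b in auto)
  also have "\<dots> = b ^ 2 * (\<Sum>a\<in>UNIV-{0::'k}. a ^ 2)"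
    by (simp add: power_mult_distrib sum_distrib_left)
  finally have "(b ^ 2 - 1) * (\<Sum>a\<in>UNIV-{0::'k}. a ^ 2) = 0"
    by (simp only: left_diff_distrib) simp
  then show *: "(\<Sum>a\<in>UNIV-{0::'k}. a ^ 2) = 0"
    using b by simp
  have "(\<Sum>a\<in>UNIV-{0::'k}. inverse a ^ 2) = (\<Sum>a\<in>UNIV-{0::'k}. a ^ 2)"
    by (rule sum.reindex_bij_witness[of _ inverse inverse]) auto
  then show "(\<Sum>a\<in>UNIV-{0::'k}. inverse a ^ 2) = 0"
    using * by simp
qed

text \<open>In characteristic 2 squaring is injective, hence surjective on a finite field; otherwise
  s = ((s+1)/2)^2 - ((s-1)/2)^2. Conjugation by unipotents and by the torus yields scalings by
  squares only, and this extends them to all scalars.\<close>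

lemma finite_field_square_or_diff_squares:
  fixes s :: "'k::{field,finite}"
  obtains a b where "s = a ^ 2 - b ^ 2"
proof (cases "(2::'k) = 0")
  case True
  have "inj (\<lambda>a::'k. a ^ 2)"
  proof (rule injI)
    fix a b :: 'k assume "a ^ 2 = b ^ 2"
    then have "(a - b) ^ 2 = 2 * b * (b - a)"
      by (simp add: power2_eq_square algebra_simps)
    then show "a = b"
      using True by simp
  qed
  then have "surj (\<lambda>a::'k. a ^ 2)"
    by (rule finite_UNIV_inj_surj[OF finite])
  from surjD[OF this, of s] obtain a where "s = a ^ 2"
    by blast
  then show ?thesis
    using that[of a 0] by simp
next
  case False
  then obtain c :: 'k where "2 * c = 1"
    by (metis right_inverse)
  moreover have "(c * (s + 1)) ^ 2 - (c * (s - 1)) ^ 2 = (2 * c) * (2 * c) * s"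
    by (simp add: power2_eq_square algebra_simps)
  ultimately have "s = (c * (s + 1)) ^ 2 - (c * (s - 1)) ^ 2"
    by simp
  then show ?thesis
    using that by blast
qed

section \<open>Square-zero extensions of a finite field\<close>

text \<open>Coordinates with respect to the standard basis of sl_2. The matrix
  \<open>tz h 0 0\<close> is scalar exactly when h + h = 0.\<close>

definition tz :: "'a::ab_group_add \<Rightarrow> 'a \<Rightarrow> 'a \<Rightarrow> 'a^2^2" where
  "tz h e f = mat2 h e f (- h)"

lemma tz_eq_iff [simp]: "tz h e f = tz h' e' f' \<longleftrightarrow> h = h' \<and> e = e' \<and> f = f'"
  by (auto simp: tz_def)

lemma tz_add [simp]: "tz h e f + tz h' e' f' = tz (h + h') (e + e') (f + f')"
  by (simp add: tz_def)

lemma tz_diff [simp]: "tz h e f - tz h' e' f' = tz (h - h') (e - e') (f - f')"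
  by (simp add: tz_def)

lemma tz_uminus [simp]: "- tz h e f = tz (- h) (- e) (- f)"
  by (simp add: tz_def)

lemma zero_conv_tz: "0 = tz 0 0 0"
  by (simp add: tz_def zero_conv_mat2)

lemma sum_tz: "(\<Sum>a\<in>S. tz (h a) (e a) (f a)) = tz (\<Sum>a\<in>S. h a) (\<Sum>a\<in>S. e a) (\<Sum>a\<in>S. f a)"
  by (induction S rule: infinite_finite_induct) (simp_all add: zero_conv_tz)

lemma tz_carrier [simp]:
  assumes "\<And>x. x \<in> S \<Longrightarrow> - x \<in> S"
  shows "tz h e f \<in> carrier (M20 S) \<longleftrightarrow> h \<in> S \<and> e \<in> S \<and> f \<in> S"
  using assms by (auto simp: tz_def M20_carrier_mat2)

lemma M20_carrier_obtains_tz: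
  assumes "A \<in> carrier (M20 S)"
  obtains h e f where "A = tz h e f" "h \<in> S" "e \<in> S" "f \<in> S"
proof -
  have "A $ 2 $ 2 = - A $ 1 $ 1"
    using assms by (simp add: M20_carrier trace_def sum_2 eq_neg_iff_add_eq_0 add.commute)
  then have "A = tz (A $ 1 $ 1) (A $ 1 $ 2) (A $ 2 $ 1)"
    by (simp add: tz_def mat_eq_iff_2)
  then show ?thesis
    using that assms by (simp add: M20_carrier)
qed

locale square_zero_extension =
  fixes \<iota> :: "'k::{field,finite} \<Rightarrow> 't::comm_ring_1" and m :: "'t set"
  assumes \<iota>_add: "\<iota> (a + b) = \<iota> a + \<iota> b"
    and \<iota>_mult: "\<iota> (a * b) = \<iota> a * \<iota> b"
    and \<iota>_1 [simp]: "\<iota> 1 = 1"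
    and m_0 [simp]: "0 \<in> m"
    and m_add: "x \<in> m \<Longrightarrow> y \<in> m \<Longrightarrow> x + y \<in> m"
    and m_mult: "x \<in> m \<Longrightarrow> t * x \<in> m"
    and m_square: "x \<in> m \<Longrightarrow> y \<in> m \<Longrightarrow> x * y = 0"
begin

lemma \<iota>_0 [simp]: "\<iota> 0 = 0"
  using \<iota>_add[of 0 0] by simp

lemma \<iota>_uminus: "\<iota> (- a) = - \<iota> a"
  using \<iota>_add[of a "- a"] by (simp add: eq_neg_iff_add_eq_0 add.commute)

lemma \<iota>_diff: "\<iota> (a - b) = \<iota> a - \<iota> b"
  using \<iota>_add[of a "- b"] by (simp add: \<iota>_uminus)

lemma \<iota>_of_nat: "\<iota> (of_nat n) = of_nat n"
  by (induction n) (simp_all add: \<iota>_add)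

lemma \<iota>_2: "\<iota> 2 = 2"
  using \<iota>_of_nat[of 2] by simp

lemma \<iota>_sum: "\<iota> (\<Sum>a\<in>S. f a) = (\<Sum>a\<in>S. \<iota> (f a))"
  by (induction S rule: infinite_finite_induct) (simp_all add: \<iota>_add)

lemma \<iota>_inverse_cancel: "a \<noteq> 0 \<Longrightarrow> \<iota> a * (\<iota> (inverse a) * x) = x"
  "a \<noteq> 0 \<Longrightarrow> \<iota> (inverse a) * (\<iota> a * x) = x"
  by (simp_all add: mult.assoc[symmetric] \<iota>_mult[symmetric])

text \<open>Translation by 1 permutes the field, so summing all y + 1 and all y gives the same value
  and q = 0. Hence q - 1 acts as -1, which makes averaging over the torus and its exponent
  usable.\<close>

lemma of_nat_card_mult: "of_nat CARD('k) * (x::'t) = 0"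
proof -
  have "(\<Sum>y\<in>(UNIV::'k set). y + 1) = (\<Sum>y\<in>(UNIV::'k set). y)"
    by (rule sum.reindex_bij_witness[of _ "\<lambda>y. y - 1" "\<lambda>y. y + 1"]) auto
  then have "of_nat CARD('k) = (0::'k)"
    by (simp add: sum.distrib)
  then show ?thesis
    using \<iota>_of_nat[of "CARD('k)"] by simp
qed

lemma m_uminus: "x \<in> m \<Longrightarrow> - x \<in> m"
  using m_mult[of x "- 1"] by simp

lemma m_diff: "x \<in> m \<Longrightarrow> y \<in> m \<Longrightarrow> x - y \<in> m"
  using m_add[of x "- y"] m_uminus by simp

lemma m_mult': "x \<in> m \<Longrightarrow> x * t \<in> m"
  using m_mult[of x t] by (simp add: mult.commute)

abbreviation lift :: "'k^2^2 \<Rightarrow> 't^2^2" where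
  "lift \<equiv> map_matrix \<iota>"

definition act :: "'k^2^2 \<Rightarrow> 't^2^2 \<Rightarrow> 't^2^2" where
  "act g = conj_mat (lift g)"

lemma act_add: "act g (A + B) = act g A + act g B"
  and act_diff: "act g (A - B) = act g A - act g B"
  and act_zero [simp]: "act g 0 = 0"
  by (simp_all add: act_def conj_mat_add conj_mat_diff)

lemma lift_mult: "lift (g ** h) = lift g ** lift h"
  by (simp add: mat_eq_iff_2 matrix_matrix_mult_def sum_2 \<iota>_add \<iota>_mult)

lemma lift_one [simp]: "lift (mat 1) = mat 1"
  by (simp add: mat_conv_mat2)

lemma det_lift: "det (lift g) = \<iota> (det g)"
  by (simp add: det_2 \<iota>_diff \<iota>_mult)

lemma trace_lift: "trace (lift g) = \<iota> (trace g)"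
  by (simp add: trace_def sum_2 \<iota>_add)

lemma invertible_lift: "invertible g \<Longrightarrow> invertible (lift g)"
  unfolding invertible_def by (metis lift_mult lift_one)

lemma GL2_invertible: "g \<in> carrier (GL2 D) \<Longrightarrow> invertible g"
  by (simp add: GL2_def)

lemma GL2_invertible_lift: "g \<in> carrier (GL2 D) \<Longrightarrow> invertible (lift g)"
  by (simp add: GL2_def invertible_lift)

lemma act_one [simp]: "act (mat 1) A = A"
  by (simp add: act_def)

lemma act_mult:
  "invertible g \<Longrightarrow> invertible h \<Longrightarrow> act (g ** h) A = act g (act h A)"
  by (simp add: act_def lift_mult conj_mat_mult invertible_lift)

lemma matrix_mult_entries_in_m:
  assumes "\<And>i j. A $ i $ j \<in> m"
  shows "((B::'t^2^2) ** A) $ i $ j \<in> m" "(A ** (B::'t^2^2)) $ i $ j \<in> m"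
  using assms by (auto simp: matrix_matrix_mult_def sum_2 intro: m_add m_mult m_mult')

lemma act_entries_in_m: "(\<And>i j. A $ i $ j \<in> m) \<Longrightarrow> act g A $ i $ j \<in> m"
  unfolding act_def conj_mat_def by (intro matrix_mult_entries_in_m)

lemma trace_act: "invertible g \<Longrightarrow> trace (act g A) = trace A"
  by (simp add: act_def trace_conj_mat invertible_lift)

lemma act_M20: "invertible g \<Longrightarrow> A \<in> carrier (M20 m) \<Longrightarrow> act g A \<in> carrier (M20 m)"
  by (auto simp: M20_carrier trace_act intro: act_entries_in_m)

lemma M20_add: "A \<in> carrier (M20 m) \<Longrightarrow> Y \<in> carrier (M20 m) \<Longrightarrow> A + Y \<in> carrier (M20 m)"
  by (auto simp: M20_carrier trace_add intro: m_add)

lemma M20_diff: "A \<in> carrier (M20 m) \<Longrightarrow> Y \<in> carrier (M20 m) \<Longrightarrow> A - Y \<in> carrier (M20 m)"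
  by (auto simp: M20_carrier trace_sub intro: m_diff)

lemma act_minus_self_M20:
  "invertible g \<Longrightarrow> (\<And>i j. E $ i $ j \<in> m) \<Longrightarrow> act g E - E \<in> carrier (M20 m)"
  by (auto simp: M20_carrier trace_sub trace_act intro: m_diff act_entries_in_m)

text \<open>The term with factor 2 is the only trace that \<open>h\<close> leaves outside the
  diagonal; its disappearance in characteristic 2 is what frees \<open>V\<close> from
  \<open>W\<close>.\<close>

lemma act_unipotent:
  "act (mat2 1 y 0 1) (tz h e f) = tz (h + \<iota> y * f) (e - 2 * \<iota> y * h - \<iota> (y\<^sup>2) * f) f"
proof -
  have "act (mat2 1 y 0 1) (tz h e f) = mat2 1 (\<iota> y) 0 1 ** tz h e f ** mat2 1 (- \<iota> y) 0 1"
    unfolding act_def map_matrix_mat2 by (simp, rule conj_mat_eqI) (simp_all add: mat_conv_mat2)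
  then show ?thesis
    by (simp add: tz_def \<iota>_mult power2_eq_square algebra_simps)
qed

lemma act_lower_unipotent:
  "act (mat2 1 0 y 1) (tz h e f) = tz (h - \<iota> y * e) e (f + 2 * \<iota> y * h - \<iota> (y\<^sup>2) * e)"
proof -
  have "act (mat2 1 0 y 1) (tz h e f) = mat2 1 0 (\<iota> y) 1 ** tz h e f ** mat2 1 0 (- \<iota> y) 1"
    unfolding act_def map_matrix_mat2 by (simp, rule conj_mat_eqI) (simp_all add: mat_conv_mat2)
  then show ?thesis
    by (simp add: tz_def \<iota>_mult power2_eq_square algebra_simps)
qed

lemma act_diagonal_mat2:
  assumes "a \<noteq> 0" "b \<noteq> 0"
  shows "act (mat2 a 0 0 b) (mat2 w x y z) = mat2 w (\<iota> (a / b) * x) (\<iota> (b / a) * y) z"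
proof -
  have "act (mat2 a 0 0 b) (mat2 w x y z) =
      mat2 (\<iota> a) 0 0 (\<iota> b) ** mat2 w x y z ** mat2 (\<iota> (inverse a)) 0 0 (\<iota> (inverse b))"
    unfolding act_def map_matrix_mat2 \<iota>_0 by (rule conj_mat_eqI) (simp_all add: mat_conv_mat2 \<iota>_mult[symmetric] assms)
  moreover have "\<iota> a * \<iota> (inverse a) = 1" "\<iota> b * \<iota> (inverse b) = 1"
    by (simp_all add: \<iota>_mult[symmetric] assms)
  ultimately show ?thesis
    by (simp add: divide_inverse \<iota>_mult mult_ac)
qed

lemma act_diagonal:
  assumes "a \<noteq> 0" "b \<noteq> 0"
  shows "act (mat2 a 0 0 b) (tz h e f) = tz h (\<iota> (a / b) * e) (\<iota> (b / a) * f)"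
  using assms by (simp add: tz_def act_diagonal_mat2)

lemma act_weyl: "act (mat2 0 1 (-1) 0) (tz h e f) = tz (- h) (- f) (- e)"
proof -
  have "act (mat2 0 1 (-1) 0) (tz h e f) = mat2 0 1 (-1) 0 ** tz h e f ** mat2 0 (-1) 1 0"
    unfolding act_def map_matrix_mat2 by (simp add: \<iota>_uminus, rule conj_mat_eqI) (simp_all add: mat_conv_mat2)
  then show ?thesis
    by (simp add: tz_def)
qed

end

text \<open>\<open>R g A\<close> expresses that \<open>A\<close> represents the value at \<open>g\<close> of a 1-cocycle with values in the
  quotient of \<open>M20 m\<close> by the submodule \<open>{A. R (mat 1) A}\<close>; a relation avoids forming the quotient.\<close>

locale cocycle_rel = square_zero_extension \<iota> m
  for \<iota> :: "'k::{field,finite} \<Rightarrow> 't::comm_ring_1" and m :: "'t set" +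
  fixes D :: "'k set" and R :: "'k^2^2 \<Rightarrow> 't^2^2 \<Rightarrow> bool"
  assumes card_gt_3: "CARD('k) > 3"
    and card_gt_5: "(2::'k) \<noteq> 0 \<Longrightarrow> CARD('k) > 5"
    and one_in_D: "1 \<in> D"
    and R_carrier: "R g A \<Longrightarrow> g \<in> carrier (GL2 D) \<and> A \<in> carrier (M20 m)"
    and R_total: "g \<in> carrier (GL2 D) \<Longrightarrow> \<exists>A. R g A"
    and R_mult: "R g A \<Longrightarrow> R h Y \<Longrightarrow> R (g ** h) (A + act g Y)"
    and R_diff: "R g A \<Longrightarrow> R g Y \<Longrightarrow> R (mat 1) (A - Y)"
begin

lemma mat2_in_GL2: "a * d - b * c = 1 \<Longrightarrow> mat2 a b c d \<in> carrier (GL2 D)"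
  by (simp add: GL2_carrier_field one_in_D)

lemma diag_in_GL2: "a * b \<in> D \<Longrightarrow> a \<noteq> 0 \<Longrightarrow> b \<noteq> 0 \<Longrightarrow> mat2 a 0 0 b \<in> carrier (GL2 D)"
  by (simp add: GL2_carrier_field)

lemma R_total_tz:
  assumes "g \<in> carrier (GL2 D)"
  obtains h e f where "R g (tz h e f)" "h \<in> m" "e \<in> m" "f \<in> m"
  using R_total[OF assms] R_carrier M20_carrier_obtains_tz by metis

lemma R_one_zero: "R (mat 1) 0"
proof -
  have "mat 1 \<in> carrier (GL2 D)"
    by (simp add: mat_conv_mat2 mat2_in_GL2)
  then obtain A where "R (mat 1) A"
    using R_total by blast
  from R_diff[OF this this] show ?thesis
    by simp
qed

lemma R_one_add_left: "R (mat 1) Z \<Longrightarrow> R g A \<Longrightarrow> R g (Z + A)"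
  using R_mult[of "mat 1" Z g A] by simp

lemma R_one_uminus: "R (mat 1) Z \<Longrightarrow> R (mat 1) (- Z)"
  using R_diff[OF R_one_zero, of Z] by simp

lemma R_one_act:
  assumes "R (mat 1) Z" "g \<in> carrier (GL2 D)"
  shows "R (mat 1) (act g Z)"
proof -
  obtain A where A: "R g A"
    using R_total assms by blast
  have "R g (A + act g Z)"
    using R_mult[OF A assms(1)] by simp
  from R_diff[OF this A] show ?thesis
    by simp
qed

lemma R_one_sum: "(\<And>a. a \<in> S \<Longrightarrow> R (mat 1) (Z a)) \<Longrightarrow> R (mat 1) (\<Sum>a\<in>S. Z a)"
  by (induction S rule: infinite_finite_induct) (simp_all add: R_one_zero R_one_add_left)

lemma R_one_diff: "R (mat 1) Z \<Longrightarrow> R (mat 1) Z' \<Longrightarrow> R (mat 1) (Z - Z')"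
  by (rule R_diff)

section \<open>The kernel in terms of its diagonal and off-diagonal entries\<close>

definition V :: "'t set" where "V = {h. R (mat 1) (tz h 0 0)}"

definition W :: "'t set" where "W = {e. R (mat 1) (tz 0 e 0)}"

lemma V_subset: "V \<subseteq> m"
  using R_carrier by (fastforce simp: V_def m_uminus)

lemma W_subset: "W \<subseteq> m"
  using R_carrier by (fastforce simp: W_def m_uminus)

lemma V_0 [simp]: "0 \<in> V" and W_0 [simp]: "0 \<in> W"
  using R_one_zero by (simp_all add: V_def W_def zero_conv_tz)

lemma V_add: "x \<in> V \<Longrightarrow> y \<in> V \<Longrightarrow> x + y \<in> V" and W_add: "x \<in> W \<Longrightarrow> y \<in> W \<Longrightarrow> x + y \<in> W"
  using R_one_add_left[of _ "mat 1"] by (fastforce simp: V_def W_def)+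

lemma V_diff: "x \<in> V \<Longrightarrow> y \<in> V \<Longrightarrow> x - y \<in> V" and W_diff: "x \<in> W \<Longrightarrow> y \<in> W \<Longrightarrow> x - y \<in> W"
  using R_one_diff by (fastforce simp: V_def W_def)+

lemma V_uminus: "x \<in> V \<Longrightarrow> - x \<in> V" and W_uminus: "x \<in> W \<Longrightarrow> - x \<in> W"
  using V_diff[of 0] W_diff[of 0] by simp_all

text \<open>Summing the conjugates by \<open>diag(a, 1/a)\<close> kills the off-diagonal entries, since the nonzero
  squares of a field with more than three elements sum to 0.\<close>

lemma R_one_diagonal_part:
  assumes "R (mat 1) (tz h e f)"
  shows "R (mat 1) (tz h 0 0)"
proof -
  let ?t = "\<lambda>a::'k. mat2 a 0 0 (inverse a)"
  have "R (mat 1) (\<Sum>a\<in>UNIV-{0}. act (?t a) (tz h e f))"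
    by (intro R_one_sum R_one_act assms) (simp add: mat2_in_GL2)
  also have "(\<Sum>a\<in>UNIV-{0}. act (?t a) (tz h e f)) =
      (\<Sum>a\<in>UNIV-{0}. tz h (\<iota> (a ^ 2) * e) (\<iota> (inverse a ^ 2) * f))"
    by (intro sum.cong) (simp_all add: act_diagonal power2_eq_square divide_inverse)
  also have "\<dots> = tz (of_nat (CARD('k) - 1) * h) 0 0"
    by (simp add: sum_tz sum_distrib_right[symmetric] \<iota>_sum[symmetric]
      sum_nonzero_squares_eq_0 card_gt_3)
  also have "of_nat (CARD('k) - 1) * h = - h"
    using of_nat_card_mult[of h] card_gt_3 by (simp add: of_nat_diff left_diff_distrib)
  finally show ?thesis
    using R_one_uminus by fastforce
qed

text \<open>Subtracting the matrix from its conjugate by an upper unipotent leaves the coordinates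
  (y f, - y^2 f, 0). Splitting off the diagonal part puts y^2 f into \<open>W\<close>, and
  differences of squares give every multiple of f. The Weyl element carries these multiples back to
  the lower corner, so that e can be isolated as well.\<close>

lemma R_one_lower_part:
  assumes "R (mat 1) (tz 0 e f)"
  shows "\<iota> s * f \<in> W" "\<iota> s * f \<in> V" "e \<in> W" "R (mat 1) (tz 0 0 (\<iota> s * f))"
proof -
  have R_mult_squares: "\<iota> y * f \<in> V \<and> \<iota> (y ^ 2) * f \<in> W" for y
  proof -
    have "R (mat 1) (act (mat2 1 y 0 1) (tz 0 e f) - tz 0 e f)"
      by (intro R_one_diff R_one_act assms mat2_in_GL2) simp
    then have *: "R (mat 1) (tz (\<iota> y * f) (- (\<iota> (y ^ 2) * f)) 0)"
      by (simp add: act_unipotent)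
    from R_one_diff[OF this R_one_diagonal_part[OF this]] R_one_diagonal_part[OF this]
    show ?thesis
      using R_one_uminus[of "tz 0 (- (\<iota> (y ^ 2) * f)) 0"] by (simp add: V_def W_def)
  qed
  have W: "\<iota> s * f \<in> W" for s
  proof -
    obtain a b where "s = a ^ 2 - b ^ 2"
      using finite_field_square_or_diff_squares by blast
    then have "\<iota> s * f = \<iota> (a ^ 2) * f - \<iota> (b ^ 2) * f"
      by (simp add: \<iota>_diff left_diff_distrib)
    then show ?thesis
      using W_diff R_mult_squares by simp
  qed
  have L: "R (mat 1) (tz 0 0 (\<iota> s * f))" for s
  proof -
    have "R (mat 1) (act (mat2 0 1 (-1) 0) (tz 0 (\<iota> s * f) 0))"
      using W[of s] by (intro R_one_act mat2_in_GL2) (simp_all add: W_def)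
    then show ?thesis
      using R_one_uminus[of "tz 0 0 (- (\<iota> s * f))"] by (simp add: act_weyl)
  qed
  show "\<iota> s * f \<in> W" "\<iota> s * f \<in> V" "R (mat 1) (tz 0 0 (\<iota> s * f))"
    using W L R_mult_squares by auto
  show "e \<in> W"
    using R_one_diff[OF assms L[of 1]] by (simp add: W_def)
qed

lemma W_iff_lower: "e \<in> W \<longleftrightarrow> R (mat 1) (tz 0 0 e)"
proof
  assume "R (mat 1) (tz 0 0 e)"
  from R_one_lower_part(1)[OF this, of 1] show "e \<in> W"
    by simp
next
  assume "e \<in> W"
  then have "R (mat 1) (act (mat2 0 1 (-1) 0) (tz 0 e 0))"
    by (intro R_one_act mat2_in_GL2) (simp_all add: W_def)
  then show "R (mat 1) (tz 0 0 e)"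
    using R_one_uminus[of "tz 0 0 (- e)"] by (simp add: act_weyl)
qed

lemma W_mult: "e \<in> W \<Longrightarrow> \<iota> s * e \<in> W"
  using R_one_lower_part(1) W_iff_lower by blast

lemma W_subset_V: "W \<subseteq> V"
  using R_one_lower_part(2)[of 0 _ 1] W_iff_lower by auto

lemma W_mult_cancel: "s \<noteq> 0 \<Longrightarrow> \<iota> s * e \<in> W \<Longrightarrow> e \<in> W"
  using W_mult[of "\<iota> s * e" "inverse s"] by (simp add: \<iota>_inverse_cancel)

text \<open>A diagonal matrix and its conjugate by a unipotent differ only in the upper right entry,
  by 2 y h. For odd characteristic this yields \<open>V = W\<close>.\<close>

lemma two_V_subset_W: 
  assumes "h \<in> V"
  shows "2 * \<iota> y * h \<in> W"
proof -
  have "R (mat 1) (act (mat2 1 y 0 1) (tz h 0 0) - tz h 0 0)"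
    by (intro R_one_diff R_one_act mat2_in_GL2) (use assms in \<open>simp_all add: V_def\<close>)
  then show ?thesis
    using W_uminus[of "- (2 * \<iota> y * h)"] by (simp add: act_unipotent W_def)
qed

text \<open>The diagonal part and both corners of a kernel element lie in the kernel separately.
  From here on, equality of cocycle values can be tested one coordinate at a time.\<close>

lemma R_one_tz_iff: "R (mat 1) (tz h e f) \<longleftrightarrow> h \<in> V \<and> e \<in> W \<and> f \<in> W"
proof
  assume *: "R (mat 1) (tz h e f)"
  then have "R (mat 1) (tz 0 e f)"
    using R_one_diff[OF _ R_one_diagonal_part[OF *], of "tz h e f"] by simp
  then show "h \<in> V \<and> e \<in> W \<and> f \<in> W"
    using R_one_diagonal_part[OF *] R_one_lower_part[of e f] W_iff_lower R_one_lower_part(1)[of e f 1] by (simp add: V_def)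
next
  assume "h \<in> V \<and> e \<in> W \<and> f \<in> W"
  then have "R (mat 1) (tz h 0 0 + (tz 0 e 0 + tz 0 0 f))"
    unfolding W_iff_lower[of f] by (intro R_one_add_left) (simp_all add: V_def W_def)
  then show "R (mat 1) (tz h e f)"
    by simp
qed

lemma R_unique:
  assumes "R g (tz h e f)" "R g (tz h' e' f')"
  shows "h - h' \<in> V" "e - e' \<in> W" "f - f' \<in> W"
  using R_diff[OF assms] by (simp_all add: R_one_tz_iff)

lemma R_change:
  assumes "R g (tz h e f)" "h' - h \<in> V" "e' - e \<in> W" "f' - f \<in> W"
  shows "R g (tz h' e' f')"
  using R_one_add_left[OF _ assms(1), of "tz (h' - h) (e' - e) (f' - f)"] assms
  by (simp add: R_one_tz_iff)

lemma V_eq_W_of_odd: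
  assumes "(2::'k) \<noteq> 0"
  shows "V = W"
proof -
  have "h \<in> W" if "h \<in> V" for h
    using two_V_subset_W[OF that, of "inverse 2"] \<iota>_inverse_cancel(1)[OF assms, of h]
    by (simp add: \<iota>_2 mult.assoc)
  then show ?thesis
    using W_subset_V by blast
qed


text \<open>Subtracting a coboundary from the cocycle preserves the cocycle identity, and at
  \<open>mat 1\<close> it changes nothing. The trace of \<open>E\<close> is arbitrary because
  conjugation preserves it, so \<open>act g E - E\<close> has trace zero anyway. Normalizations can
  thus be iterated by interpreting the locale again.\<close>

lemma R_shift:
  assumes "\<And>i j. E $ i $ j \<in> m"
  shows "cocycle_rel \<iota> m D (\<lambda>g A. R g (A + act g E - E))"
proof (unfold_locales, goal_cases)
  case (4 g A)
  then have g: "g \<in> carrier (GL2 D)" and "A + (act g E - E) \<in> carrier (M20 m)"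
    using R_carrier by (simp_all add: add_diff_eq)
  moreover have "act g E - E \<in> carrier (M20 m)"
    by (intro act_minus_self_M20 assms GL2_invertible[OF g])
  ultimately show ?case
    using M20_diff[of "A + (act g E - E)" "act g E - E"] by simp
next
  case (5 g)
  then obtain A where "R g A"
    using R_total by blast
  then show ?case
    by (intro exI[of _ "A - act g E + E"]) simp
next
  case (6 g A h B)
  have "invertible g" "invertible h"
    using 6 R_carrier GL2_invertible by blast+
  then show ?case
    using R_mult[OF 6] by (simp add: act_mult act_add act_diff algebra_simps)
next
  case (7 g A B)
  then show ?case
    using R_diff[OF 7] by simp
qed (use card_gt_3 card_gt_5 one_in_D in auto)

section \<open>Normalizing the cocycle on the torus, the unipotents and the Weyl element\<close>

lemma torus_cocycle_normalize:
  assumes "a \<noteq> 0" "a ^ 2 \<noteq> 1"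
  obtains E h where "\<And>i j. E $ i $ j \<in> m"
    "R (mat2 a 0 0 (inverse a)) (tz h 0 0 + act (mat2 a 0 0 (inverse a)) E - E)"
proof -
  let ?z = "mat2 a 0 0 (inverse a)"
  have "?z \<in> carrier (GL2 D)"
    using assms by (intro mat2_in_GL2) simp
  then obtain h e f where z: "R ?z (tz h e f)" "h \<in> m" "e \<in> m" "f \<in> m"
    using R_total_tz by blast
  \<comment> \<open>On the two off-diagonal coordinates \<open>act ?z - 1\<close> is multiplication
    by a^2 - 1 and a^-2 - 1, which are invertible; \<open>E\<close> is the preimage of (e, f). On
    the diagonal coordinate it is zero, so h has to survive here.\<close>
  define b c where "b = inverse (a ^ 2 - 1)" and "c = inverse (inverse a ^ 2 - 1)"
  define E where "E = tz 0 (\<iota> b * e) (\<iota> c * f)"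
  have n: "a ^ 2 - 1 \<noteq> 0" "inverse a ^ 2 - 1 \<noteq> 0"
    using assms by (auto simp: power_inverse)
  have "E $ i $ j \<in> m" for i j
    using z m_mult m_0 by (cases i rule: exhaust_2[THEN disjE]; cases j rule: exhaust_2[THEN disjE])
      (auto simp: E_def tz_def)
  moreover have "act ?z E - E = tz 0 (\<iota> (a ^ 2 - 1) * (\<iota> b * e)) (\<iota> (inverse a ^ 2 - 1) * (\<iota> c * f))"
    using assms by (simp add: E_def act_diagonal divide_inverse power2_eq_square \<iota>_diff left_diff_distrib)
  then have "act ?z E - E = tz 0 e f"
    using n by (simp add: b_def c_def \<iota>_inverse_cancel)
  then have "tz h 0 0 + act ?z E - E = tz h e f"
    by (simp add: add_diff_eq[symmetric])
  ultimately show ?thesis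
    using that[of E h] z by simp
qed

text \<open>Diagonal matrices act trivially on the diagonal coordinate, so there the cocycle is a
  homomorphism.\<close>

lemma torus_power:
  assumes "R (mat2 b 0 0 c) (tz h 0 0)" "b \<noteq> 0" "c \<noteq> 0"
  shows "R (mat2 (b ^ n) 0 0 (c ^ n)) (tz (of_nat n * h) 0 0)"
proof (induction n)
  case 0
  then show ?case
    using R_one_zero by (simp add: mat_conv_mat2 zero_conv_tz)
next
  case (Suc n)
  from R_mult[OF assms(1) Suc] show ?case
    using assms by (simp add: act_diagonal algebra_simps)
qed

text \<open>The torus is commutative of exponent prime to the characteristic.\<close>

lemma torus_cocycle_trivial:
  assumes a: "a \<noteq> 0" "a ^ 2 \<noteq> 1" and z: "R (mat2 a 0 0 (inverse a)) (tz h0 0 0)"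
    and bc: "b * c \<in> D" "b \<noteq> 0" "c \<noteq> 0"
  shows "R (mat2 b 0 0 c) 0"
proof -
  let ?z = "mat2 a 0 0 (inverse a)" and ?t = "mat2 b 0 0 c"
  obtain h e f where t: "R ?t (tz h e f)" "h \<in> m" "e \<in> m" "f \<in> m"
    using R_total_tz diag_in_GL2[OF bc] by blast
  \<comment> \<open>The commuting product is evaluated in both orders: \<open>?z\<close> scales the
    off-diagonal entries of the value at \<open>?t\<close>, whereas \<open>?t\<close> fixes the
    diagonal value at \<open>?z\<close>.\<close>
  have 1: "R (?t ** ?z) (tz (h + h0) e f)"
    using R_mult[OF t(1) z] bc by (simp add: act_diagonal)
  have 2: "R (?t ** ?z) (tz (h + h0) (\<iota> (a ^ 2) * e) (\<iota> (inverse a ^ 2) * f))"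
    using R_mult[OF z t(1)] a
    by (simp add: act_diagonal divide_inverse power2_eq_square mult.commute add.commute)
  have "\<iota> (a ^ 2 - 1) * e \<in> W" "\<iota> (inverse a ^ 2 - 1) * f \<in> W"
    using R_unique[OF 2 1] by (simp_all add: \<iota>_diff left_diff_distrib)
  moreover have "a ^ 2 - 1 \<noteq> 0" "inverse a ^ 2 - 1 \<noteq> 0"
    using a by (auto simp: power_inverse)
  ultimately have ef: "e \<in> W" "f \<in> W"
    using W_mult_cancel by blast+
  then have t': "R ?t (tz h 0 0)"
    using R_change[OF t(1)] W_uminus by simp
  \<comment> \<open>The power with exponent q - 1 of \<open>?t\<close> is the identity, so a
    multiple of h that equals - h lies in \<open>V\<close>.\<close>
  have "R (mat 1) (tz (of_nat (CARD('k) - 1) * h) 0 0)"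
    using torus_power[OF t' bc(2,3), of "CARD('k) - 1"]
    unfolding finite_field_power_card_minus_1[OF bc(2)] finite_field_power_card_minus_1[OF bc(3)]
    by (simp add: mat_conv_mat2)
  moreover have "of_nat (CARD('k) - 1) * h = - h"
    using of_nat_card_mult[of h] card_gt_3 by (simp add: of_nat_diff left_diff_distrib)
  ultimately have "- h \<in> V"
    by (simp add: R_one_tz_iff)
  then show ?thesis
    using R_change[OF t', of 0 0 0] by (simp add: zero_conv_tz)
qed

text \<open>Vanishing on the torus forces h, e and f to have weights 0, 2 and -2 under x -> a^2 x,
  while the cocycle identity makes them additive up to mixed terms. Modulo the kernel only a linear
  e satisfies both.\<close>

lemma unipotent_cocycle:
  assumes T: "\<And>b c. b * c \<in> D \<Longrightarrow> b \<noteq> 0 \<Longrightarrow> c \<noteq> 0 \<Longrightarrow> R (mat2 b 0 0 c) 0"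
  obtains \<delta> where "\<delta> \<in> m" "\<And>x. R (mat2 1 x 0 1) (tz 0 (\<iota> x * \<delta>) 0)"
proof -
  let ?u = "\<lambda>x::'k. mat2 1 x 0 1"
  have "\<exists>h e f. R (?u x) (tz h e f) \<and> h \<in> m \<and> e \<in> m \<and> f \<in> m" for x
    by (rule R_total_tz[of "?u x"]) (auto intro: mat2_in_GL2)
  then obtain h e f where u: "\<And>x. R (?u x) (tz (h x) (e x) (f x))"
    and m: "\<And>x. h x \<in> m" "\<And>x. e x \<in> m" "\<And>x. f x \<in> m"
    by metis
  have R_add: "R (?u (x + y)) (tz (h x + (h y + \<iota> x * f y))
      (e x + (e y - 2 * \<iota> x * h y - \<iota> (x\<^sup>2) * f y)) (f x + f y))" for x y
    using R_mult[OF u[of x] u[of y]] by (simp add: act_unipotent add.commute[of y])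
  note add = R_unique[OF u R_add]
  \<comment> \<open>The relation u(a^2 x) t = t u(x) is evaluated on both sides, with value 0 at the
    torus element t.\<close>
  have scale: "h (a\<^sup>2 * x) - h x \<in> V" "e (a\<^sup>2 * x) - \<iota> (a\<^sup>2) * e x \<in> W"
    "f (a\<^sup>2 * x) - \<iota> (inverse a ^ 2) * f x \<in> W" if a: "a \<noteq> 0" for a x
  proof -
    let ?t = "mat2 a 0 0 (inverse a)"
    have t: "R ?t 0"
      using a one_in_D by (intro T) auto
    have 1: "R (?t ** ?u x) (tz (h x) (\<iota> (a\<^sup>2) * e x) (\<iota> (inverse a ^ 2) * f x))"
      using R_mult[OF t u[of x]] a by (simp add: act_diagonal divide_inverse power2_eq_square)
    have ut: "?u (a\<^sup>2 * x) ** ?t = ?t ** ?u x"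
      using a by (simp add: power2_eq_square field_simps)
    have 2: "R (?t ** ?u x) (tz (h (a\<^sup>2 * x)) (e (a\<^sup>2 * x)) (f (a\<^sup>2 * x)))"
      using R_mult[OF u[of "a\<^sup>2 * x"] t] unfolding ut by simp
    show "h (a\<^sup>2 * x) - h x \<in> V" "e (a\<^sup>2 * x) - \<iota> (a\<^sup>2) * e x \<in> W"
      "f (a\<^sup>2 * x) - \<iota> (inverse a ^ 2) * f x \<in> W"
      using R_unique[OF 2 1] by simp_all
  qed
  have "R (mat 1) (tz (h 0) (e 0) (f 0))"
    using u[of 0] by (simp add: mat_conv_mat2)
  then have zero: "h 0 \<in> V" "e 0 \<in> W" "f 0 \<in> W"
    by (simp_all add: R_one_tz_iff)
  \<comment> \<open>In characteristic 2 the unipotents are involutions. In odd characteristic they commute, which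
    makes \<open>f\<close> linear, whereas the torus scales it by the inverse of a square when it scales the
    argument by that square.\<close>
  have f: "f x \<in> W" for x
  proof (cases "(2::'k) = 0")
    case True
    then have 2: "(2::'t) = 0"
      using \<iota>_2 by simp
    have dbl: "y + y = 0" for y :: 't
      using 2 by (metis mult_2 mult_zero_left)
    have dbl': "y + y = 0" for y :: 'k
      using True by (metis mult_2 mult_zero_left)
    show ?thesis
    proof (cases "x = 0")
      case False
      have "e 0 - (e x + (e x - 2 * \<iota> x * h x - \<iota> (x\<^sup>2) * f x)) \<in> W"
        using add(2)[of x x] by (simp add: dbl')
      also have "e 0 - (e x + (e x - 2 * \<iota> x * h x - \<iota> (x\<^sup>2) * f x)) =
          e 0 - (e x + e x) + 2 * \<iota> x * h x + \<iota> (x\<^sup>2) * f x"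
        by (simp add: algebra_simps)
      also have "\<dots> = e 0 + \<iota> (x\<^sup>2) * f x"
        by (simp only: dbl 2) simp
      finally have "\<iota> (x\<^sup>2) * f x \<in> W"
        using W_diff[OF _ zero(2)] by fastforce
      then show ?thesis
        using W_mult_cancel[of "x\<^sup>2"] False by simp
    qed (use zero in simp)
  next
    case False
    have VW: "V = W"
      by (rule V_eq_W_of_odd[OF False])
    have comm: "\<iota> y * f 1 - f y \<in> W" for y
    proof -
      have "(h (1 + y) - (h 1 + (h y + \<iota> 1 * f y))) - (h (y + 1) - (h y + (h 1 + \<iota> y * f 1))) \<in> W"
        using add(1) VW W_diff by blast
      then show ?thesis
        by (simp add: algebra_simps)
    qed
    obtain a :: 'k where a: "a \<noteq> 0" "a ^ 4 \<noteq> 1"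
      using card_gt_5_obtains_fourth_power_neq_1 card_gt_5 False by blast
    have "(\<iota> (a\<^sup>2) * f 1 - f (a\<^sup>2)) + (f (a\<^sup>2 * 1) - \<iota> (inverse a ^ 2) * f 1) \<in> W"
      by (intro W_add comm scale a)
    then have "\<iota> (a\<^sup>2 - inverse a ^ 2) * f 1 \<in> W"
      by (simp add: \<iota>_diff left_diff_distrib)
    moreover have "a\<^sup>2 - inverse a ^ 2 \<noteq> 0"
    proof
      assume "a\<^sup>2 - inverse a ^ 2 = 0"
      then have "a\<^sup>2 * a\<^sup>2 = inverse a ^ 2 * a\<^sup>2"
        by simp
      then show False
        using a by (simp add: power_mult_distrib[symmetric] power_add[symmetric] flip: power2_eq_square)
    qed
    ultimately have "f 1 \<in> W"
      using W_mult_cancel by blast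
    then have "\<iota> x * f 1 - (\<iota> x * f 1 - f x) \<in> W"
      by (intro W_diff W_mult comm)
    then show ?thesis
      by simp
  qed
  obtain a :: 'k where a: "a \<noteq> 0" "a ^ 2 \<noteq> 1"
    using card_gt_3_obtains_square_neq_1 card_gt_3 by blast
  have h: "h y \<in> V" for y
  proof -
    \<comment> \<open>This choice makes y + x = a^2 x: passing from x to this argument leaves h
      unchanged modulo \<open>V\<close> by scaling, yet adds h y by additivity.\<close>
    define x where "x = y / (a\<^sup>2 - 1)"
    have x: "y + x = a\<^sup>2 * x"
      using a by (simp add: x_def field_simps)
    have "(h (a\<^sup>2 * x) - h x) - (h (y + x) - (h y + (h x + \<iota> y * f x))) - \<iota> y * f x \<in> V"
      by (rule V_diff[OF V_diff[OF scale(1)[OF a(1)] add(1)] subsetD[OF W_subset_V W_mult[OF f]]])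
    then show ?thesis
      by (simp add: x)
  qed
  have e_add: "e (x + y) - (e x + e y) \<in> W" for x y
  proof -
    have "e (x + y) - (e x + (e y - 2 * \<iota> x * h y - \<iota> (x\<^sup>2) * f y)) - 2 * \<iota> x * h y - \<iota> (x\<^sup>2) * f y \<in> W"
      by (intro W_diff add two_V_subset_W W_mult f h)
    then show ?thesis
      by (simp add: algebra_simps)
  qed
  have e_square: "e (b\<^sup>2) - \<iota> (b\<^sup>2) * e 1 \<in> W" for b
    using scale(2)[of b 1] zero by (cases "b = 0") auto
  have e: "e s - \<iota> s * e 1 \<in> W" for s
  proof -
    \<comment> \<open>Linearity is so far known at squares; additivity applied to s + c^2 = b^2
      transfers it to s.\<close>
    obtain b c where s: "s = b\<^sup>2 - c\<^sup>2"
      using finite_field_square_or_diff_squares by blast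
    have "(e (b\<^sup>2) - \<iota> (b\<^sup>2) * e 1) - (e (c\<^sup>2) - \<iota> (c\<^sup>2) * e 1) - (e (s + c\<^sup>2) - (e s + e (c\<^sup>2))) \<in> W"
      by (intro W_diff e_square e_add)
    then show ?thesis
      by (simp add: s \<iota>_diff algebra_simps)
  qed
  have "R (?u x) (tz 0 (\<iota> x * e 1) 0)" for x
  proof (rule R_change[OF u])
    show "\<iota> x * e 1 - e x \<in> W"
      using W_uminus[OF e[of x]] by simp
  qed (use h f V_uminus W_uminus in auto)
  then show ?thesis
    using that m by blast
qed

text \<open>By the Bruhat decomposition the torus, the upper unipotents and the Weyl element generate.\<close>

lemma cocycle_trivial:
  assumes T: "\<And>b c. b * c \<in> D \<Longrightarrow> b \<noteq> 0 \<Longrightarrow> c \<noteq> 0 \<Longrightarrow> R (mat2 b 0 0 c) 0"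
    and U: "\<And>x. R (mat2 1 x 0 1) 0" and g: "g \<in> carrier (GL2 D)"
  shows "R g 0"
proof -
  let ?w = "mat2 0 1 (-1) 0 :: 'k^2^2"
  have R_mult_0: "R g 0 \<Longrightarrow> R h 0 \<Longrightarrow> R (g ** h) 0" for g h
    using R_mult[of g 0 h 0] by simp
  obtain h e f where w: "R ?w (tz h e f)" "h \<in> m" "e \<in> m" "f \<in> m"
    by (rule R_total_tz[of ?w]) (auto intro: mat2_in_GL2)
  obtain a :: 'k where a: "a \<noteq> 0" "a ^ 2 \<noteq> 1"
    using card_gt_3_obtains_square_neq_1 card_gt_3 by blast
  \<comment> \<open>The relation w diag(a, 1/a) = diag(1/a, a) w, evaluated on both sides, removes
    the off-diagonal entries of the value at w.\<close>
  have 1: "R (?w ** mat2 a 0 0 (inverse a)) (tz h e f)"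
    using R_mult[OF w(1) T[of a "inverse a"]] a one_in_D by simp
  have 2: "R (?w ** mat2 a 0 0 (inverse a)) (tz h (\<iota> (inverse a ^ 2) * e) (\<iota> (a ^ 2) * f))"
    using R_mult[OF T[of "inverse a" a] w(1)] a one_in_D
    by (simp add: act_diagonal divide_inverse power2_eq_square)
  have "\<iota> (a ^ 2 - 1) * f \<in> W" "\<iota> (inverse a ^ 2 - 1) * e \<in> W"
    using R_unique[OF 2 1] by (simp_all add: \<iota>_diff left_diff_distrib)
  moreover have "a ^ 2 - 1 \<noteq> 0" "inverse a ^ 2 - 1 \<noteq> 0"
    using a by (auto simp: power_inverse)
  ultimately have "e \<in> W" "f \<in> W"
    using W_mult_cancel by blast+
  then have w': "R ?w (tz h 0 0)"
    using R_change[OF w(1)] W_uminus by simp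
  \<comment> \<open>This is w u(1) w^-1, and u(1) l u(1) = w. The first relation expresses the value
    at l through h; the second then gives w the diagonal coordinate 2 h, and comparison with h shows
    that h lies in \<open>V\<close>, in every characteristic.\<close>
  let ?l = "mat2 1 0 (-1) 1 :: 'k^2^2"
  obtain h' e' f' where l: "R ?l (tz h' e' f')" "h' \<in> m" "e' \<in> m" "f' \<in> m"
    by (rule R_total_tz[of ?l]) (auto intro: mat2_in_GL2)
  have 3: "R (?w ** mat2 1 1 0 1) (tz h 0 0)"
    using R_mult[OF w' U[of 1]] by simp
  have 4: "R (?w ** mat2 1 1 0 1) (tz (h' + h) e' (f' - 2 * h))"
    using R_mult[OF l(1) w'] by (simp add: act_lower_unipotent \<iota>_uminus)
  have l': "R ?l (tz 0 0 (2 * h))"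
    using R_unique[OF 4 3] R_change[OF l(1), of 0 0 "2 * h"] V_uminus W_uminus[of "f' - 2 * h"] W_uminus[of e']
    by simp
  have "R (mat2 1 1 0 1 ** ?l) (tz (2 * h) (- (2 * h)) (2 * h))"
    using R_mult[OF U[of 1] l'] by (simp add: act_unipotent)
  then have "R (mat2 1 1 0 1 ** ?l ** mat2 1 1 0 1) (tz (2 * h) (- (2 * h)) (2 * h))"
    using R_mult[OF _ U[of 1]] by fastforce
  then have "R ?w (tz (2 * h) (- (2 * h)) (2 * h))"
    by simp
  from R_unique[OF this w'] have "2 * h - h \<in> V"
    by simp
  then have w0: "R ?w 0"
    using R_change[OF w', of 0 0 0] V_uminus[of h] by (simp add: zero_conv_tz)
  obtain p q r s where g_eq: "g = mat2 p q r s"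
    using mat2_eta by blast
  then have det: "p * s - q * r \<noteq> 0" "p * s - q * r \<in> D"
    using g by (simp_all add: GL2_carrier_field)
  show ?thesis
  proof (cases "r = 0")
    case True
    then have "g = mat2 p 0 0 s ** mat2 1 (q / p) 0 1"
      using det g_eq by simp
    then show ?thesis
      using R_mult_0[OF T[of p s] U[of "q / p"]] det True by simp
  next
    case False
    \<comment> \<open>The torus factor of the decomposition has to carry the determinant of g; this
      keeps its determinant in \<open>D\<close>, so that the hypothesis on the torus applies to
      it.\<close>
    let ?q = "q - p * s / r"
    have q: "- r * ?q = p * s - q * r"
      using False by (simp add: field_simps)
    have "g = ((mat2 1 (p / r) 0 1 ** ?w) ** mat2 (- r) 0 0 ?q) ** mat2 1 (s / r) 0 1"
      using False by (simp add: g_eq field_simps)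
    moreover have "R (mat2 (- r) 0 0 ?q) 0"
      using False q det by (intro T) auto
    ultimately show ?thesis
      using R_mult_0 U w0 by presburger
  qed
qed

theorem cocycle_coboundary:
  obtains E where "\<And>i j. E $ i $ j \<in> m" "\<And>g. g \<in> carrier (GL2 D) \<Longrightarrow> R g (act g E - E)"
proof -
  obtain a :: 'k where a: "a \<noteq> 0" "a ^ 2 \<noteq> 1"
    using card_gt_3_obtains_square_neq_1 card_gt_3 by blast
  obtain E h where E: "\<And>i j. E $ i $ j \<in> m"
    and z: "R (mat2 a 0 0 (inverse a)) (tz h 0 0 + act (mat2 a 0 0 (inverse a)) E - E)"
    using torus_cocycle_normalize[OF a] by blast
  interpret R1: cocycle_rel \<iota> m D "\<lambda>g A. R g (A + act g E - E)"
    by (rule R_shift[OF E])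
  note T1 = R1.torus_cocycle_trivial[OF a z]
  obtain \<delta> where \<delta>: "\<delta> \<in> m"
    and u: "\<And>x. R (mat2 1 x 0 1) (tz 0 (\<iota> x * \<delta>) 0 + act (mat2 1 x 0 1) E - E)"
    using R1.unipotent_cocycle[OF T1] by blast
  \<comment> \<open>A diagonal matrix commutes with the torus, so this shift keeps the cocycle zero
    there while it cancels \<delta> on the unipotents.\<close>
  let ?F = "mat2 (- \<delta>) 0 0 0"
  have F: "?F $ i $ j \<in> m" for i j
    using \<delta> exhaust_2[of i] exhaust_2[of j] by (auto intro: m_uminus)
  interpret R2: cocycle_rel \<iota> m D "\<lambda>g A. R g (A + act g ?F - ?F + act g E - E)"
    by (rule R1.R_shift[OF F])
  have "act (mat2 1 x 0 1) ?F = mat2 1 (\<iota> x) 0 1 ** ?F ** mat2 1 (- \<iota> x) 0 1" for x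
    unfolding act_def map_matrix_mat2 \<iota>_0 \<iota>_1 by (rule conj_mat_eqI) (simp_all add: mat_conv_mat2)
  then have u_F: "act (mat2 1 x 0 1) ?F - ?F = tz 0 (\<iota> x * \<delta>) 0" for x
    by (simp add: tz_def mult.commute)
  have "R g (0 + act g ?F - ?F + act g E - E)" if g: "g \<in> carrier (GL2 D)" for g
  proof (rule R2.cocycle_trivial[OF _ _ g])
    show "R (mat2 b 0 0 c) (0 + act (mat2 b 0 0 c) ?F - ?F + act (mat2 b 0 0 c) E - E)"
      if "b * c \<in> D" "b \<noteq> 0" "c \<noteq> 0" for b c
      using T1[OF that] that by (simp add: act_diagonal_mat2)
    show "R (mat2 1 x 0 1) (0 + act (mat2 1 x 0 1) ?F - ?F + act (mat2 1 x 0 1) E - E)" for x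
      using u[of x] by (simp add: u_F)
  qed
  then have "R g (act g (?F + E) - (?F + E))" if "g \<in> carrier (GL2 D)" for g
    using that by (simp add: act_add algebra_simps)
  moreover have "(?F + E) $ i $ j \<in> m" for i j
    using F E by (simp add: m_add)
  ultimately show ?thesis
    using that by blast
qed

end

section \<open>Groups with an action\<close>

text \<open>Closure under multiplication is the only structural condition, so the lemma applies to
  semidirect products and direct sums before any group axioms are established for them.\<close>

lemma inv_into_iso:
  assumes h: "h \<in> iso G H"
    and closed: "\<And>x y. x \<in> carrier G \<Longrightarrow> y \<in> carrier G \<Longrightarrow> x \<otimes>\<^bsub>G\<^esub> y \<in> carrier G"
  shows "inv_into (carrier G) h \<in> iso H G"
proof -
  have hom: "h \<in> hom G H" and bij: "bij_betw h (carrier G) (carrier H)"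
    using h by (auto simp: iso_def)
  have inv: "inv_into (carrier G) h y \<in> carrier G" "h (inv_into (carrier G) h y) = y"
    if "y \<in> carrier H" for y
    using that bij by (auto simp: bij_betw_def inv_into_into f_inv_into_f)
  have "inv_into (carrier G) h (y \<otimes>\<^bsub>H\<^esub> y') =
      inv_into (carrier G) h y \<otimes>\<^bsub>G\<^esub> inv_into (carrier G) h y'"
    if "y \<in> carrier H" "y' \<in> carrier H" for y y'
    by (rule inv_into_f_eq) (use that inv closed hom bij in \<open>auto simp: bij_betw_def hom_mult\<close>)
  then show ?thesis
    using bij_betw_inv_into[OF bij] inv by (auto simp: iso_def hom_def)
qed

lemma gmodule_iso_sym:
  assumes "gmodule_iso G M act N act'"
    and closed: "\<And>x y. x \<in> carrier M \<Longrightarrow> y \<in> carrier M \<Longrightarrow> x \<otimes>\<^bsub>M\<^esub> y \<in> carrier M"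
    and act: "\<And>g x. g \<in> carrier G \<Longrightarrow> x \<in> carrier M \<Longrightarrow> act g x \<in> carrier M"
  shows "gmodule_iso G N act' M act"
proof -
  obtain f where f: "f \<in> iso M N"
    and eq: "\<And>g x. g \<in> carrier G \<Longrightarrow> x \<in> carrier M \<Longrightarrow> f (act g x) = act' g (f x)"
    using assms(1) by (auto simp: gmodule_iso_def)
  have bij: "bij_betw f (carrier M) (carrier N)"
    using f by (simp add: iso_def)
  have inv: "inv_into (carrier M) f y \<in> carrier M" "f (inv_into (carrier M) f y) = y"
    if "y \<in> carrier N" for y
    using that bij by (auto simp: bij_betw_def inv_into_into f_inv_into_f)
  have "inv_into (carrier M) f (act' g y) = act g (inv_into (carrier M) f y)"
    if "g \<in> carrier G" "y \<in> carrier N" for g y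
    by (rule inv_into_f_eq) (use that inv act eq bij in \<open>auto simp: bij_betw_def\<close>)
  then show ?thesis
    using inv_into_iso[OF f closed] by (auto simp: gmodule_iso_def)
qed

lemma gmodule_iso_trans:
  assumes "gmodule_iso G M act N act'" "gmodule_iso G N act' P act''"
  shows "gmodule_iso G M act P act''"
proof -
  obtain f f' where f: "f \<in> iso M N" "f' \<in> iso N P"
    and eq: "\<And>g x. g \<in> carrier G \<Longrightarrow> x \<in> carrier M \<Longrightarrow> f (act g x) = act' g (f x)"
      "\<And>g x. g \<in> carrier G \<Longrightarrow> x \<in> carrier N \<Longrightarrow> f' (act' g x) = act'' g (f' x)"
    using assms by (auto simp: gmodule_iso_def)
  have "f x \<in> carrier N" if "x \<in> carrier M" for x
    using f that by (auto simp: iso_def hom_def)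
  then show ?thesis
    unfolding gmodule_iso_def using iso_set_trans[OF f] eq by (intro bexI[of _ "f' \<circ> f"]) auto
qed

lemma semidirect_simps [simp]:
  "carrier (semidirect N H act) = carrier N \<times> carrier H"
  "monoid.mult (semidirect N H act) = (\<lambda>(n, h) (n', h'). (n \<otimes>\<^bsub>N\<^esub> act h n', h \<otimes>\<^bsub>H\<^esub> h'))"
  by (simp_all add: semidirect_def)

lemma semidirect_iso:
  assumes "gmodule_iso G M act N act'"
    and act: "\<And>g x. g \<in> carrier G \<Longrightarrow> x \<in> carrier M \<Longrightarrow> act g x \<in> carrier M"
  shows "semidirect M G act \<cong> semidirect N G act'"
proof -
  obtain f where f: "f \<in> hom M N" "bij_betw f (carrier M) (carrier N)"
    and eq: "\<And>g x. g \<in> carrier G \<Longrightarrow> x \<in> carrier M \<Longrightarrow> f (act g x) = act' g (f x)"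
    using assms(1) by (auto simp: gmodule_iso_def iso_def)
  have "map_prod f id \<in> iso (semidirect M G act) (semidirect N G act')"
    unfolding iso_def
  proof (intro CollectI conjI homI)
    show "bij_betw (map_prod f id) (carrier (semidirect M G act)) (carrier (semidirect N G act'))"
      using bij_betw_map_prod[OF f(2), of id "carrier G" "carrier G"] by simp
  next
    fix x y assume "x \<in> carrier (semidirect M G act)" "y \<in> carrier (semidirect M G act)"
    then show "map_prod f id (x \<otimes>\<^bsub>semidirect M G act\<^esub> y) =
        map_prod f id x \<otimes>\<^bsub>semidirect N G act'\<^esub> map_prod f id y"
      by (auto simp: hom_mult[OF f(1)] act eq)
  qed (use f(1) in \<open>auto simp: hom_def\<close>)
  then show ?thesis
    by (auto simp: is_iso_def)
qed

section \<open>Direct sum decompositions\<close>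

text \<open>Adjoining an element u outside \<open>W\<close> doubles \<open>W\<close>, and u becomes
  the last generator; the induction is on the gap in cardinality. The element \<open>c\<close> only
  marks that a generator occurs, so that the domain is literally a power of a two-element group
  \<open>{0, c}\<close>.\<close>

lemma elementary_abelian_2_complement:
  fixes V W :: "'a::ab_group_add set" and c :: "'c::zero"
  assumes "finite V" "W \<subseteq> V" "c \<noteq> 0"
    and V: "\<And>x y. x \<in> V \<Longrightarrow> y \<in> V \<Longrightarrow> x + y \<in> V"
    and W: "0 \<in> W" "\<And>x y. x \<in> W \<Longrightarrow> y \<in> W \<Longrightarrow> x + y \<in> W"
    and double: "\<And>x. x \<in> V \<Longrightarrow> x + x = 0"
  shows "\<exists>(\<beta>::nat) v. (\<forall>j. v j \<in> V) \<and>
    bij_betw (\<lambda>(w, y). w + (\<Sum>j<\<beta>. if y j = 0 then 0 else v j)) (W \<times> ({..<\<beta>} \<rightarrow>\<^sub>E {0, c})) V"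
  using \<open>W \<subseteq> V\<close> W
proof (induction "card V - card W" arbitrary: W rule: less_induct)
  case less
  show ?case
  proof (cases "W = V")
    case True
    \<comment> \<open>Over an empty index set the extensional function space consists of the
      constant function \<open>undefined\<close>.\<close>
    have "bij_betw (\<lambda>(w, y). w + (\<Sum>j<0. if y j = 0 then 0 else (0::'a)))
        (W \<times> ({..<0::nat} \<rightarrow>\<^sub>E {0, c})) V"
      by (rule bij_betw_byWitness[of _ "\<lambda>w. (w, \<lambda>_. undefined)"]) (use True in auto)
    then show ?thesis
      using less.prems by (intro exI[of _ "0::nat"] exI[of _ "\<lambda>_::nat. 0::'a"]) auto
  next
    case False
    then obtain u where u: "u \<in> V" "u \<notin> W"
      using less.prems by blast
    have uu: "u + (u + x) = x" for x
      using double[OF u(1)] by (simp add: add.assoc[symmetric])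
    have uu': "x + u + u = x" for x
      using uu[of x] by (simp add: ac_simps)
    define W' where "W' = W \<union> (+) u ` W"
    have "u \<in> W'"
      using less.prems by (force simp: W'_def)
    have sub: "W \<subset> W'" "W' \<subseteq> V"
      using u \<open>u \<in> W'\<close> less.prems V by (auto simp: W'_def)
    have "card W < card W'" "card W' \<le> card V"
      using sub \<open>finite V\<close> by (auto intro!: psubset_card_mono card_mono finite_subset[of W' V])
    then have less_card: "card V - card W' < card V - card W"
      by linarith
    have W'_add: "x + y \<in> W'" if in_W': "x \<in> W'" "y \<in> W'" for x y
    proof -
      obtain x' y' where xy: "x' \<in> W" "y' \<in> W" "x = x' \<or> x = u + x'" "y = y' \<or> y = u + y'"
        using in_W' unfolding W'_def by blast
      have "x + y \<in> {x' + y', u + (x' + y'), u + (u + (x' + y'))}"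
        using xy(3,4) by (auto simp: algebra_simps)
      then show ?thesis
        using less.prems(3)[OF xy(1,2)] by (auto simp: W'_def uu)
    qed
    have W'_0: "0 \<in> W'"
      using less.prems(2) by (simp add: W'_def)
    obtain \<beta> :: nat and v where v: "\<forall>j. v j \<in> V"
      and bij: "bij_betw (\<lambda>(w, y). w + (\<Sum>j<\<beta>. if y j = 0 then 0 else v j))
        (W' \<times> ({..<\<beta>} \<rightarrow>\<^sub>E {0, c})) V"
      using less.hyps[OF less_card sub(2) W'_0 W'_add] by blast
    let ?f = "\<lambda>(w, y). w + (\<Sum>j<\<beta>. if y j = 0 then 0 else v j)"
    let ?v = "v(\<beta> := u)"
    let ?F = "\<lambda>(w, y). w + (\<Sum>j<Suc \<beta>. if y j = 0 then 0 else ?v j)"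
    \<comment> \<open>The last coordinate is absorbed into the enlarged group, so the sum over Suc
      \<beta> generators factors through the bijection of the induction hypothesis.\<close>
    let ?q = "\<lambda>(w, y). (w + (if y \<beta> = 0 then 0 else u), restrict y {..<\<beta>})"
    have F_eq: "?F p = ?f (?q p)" for p :: "'a \<times> (nat \<Rightarrow> 'c)"
    proof (cases p)
      case (Pair w y)
      have "(\<Sum>j<\<beta>. if y j = 0 then 0 else ?v j) = (\<Sum>j<\<beta>. if y j = 0 then 0 else v j)"
        by (rule sum.cong) auto
      then show ?thesis
        by (simp add: Pair algebra_simps)
    qed
    have "bij_betw ?q (W \<times> ({..<Suc \<beta>} \<rightarrow>\<^sub>E {0, c})) (W' \<times> ({..<\<beta>} \<rightarrow>\<^sub>E {0, c}))"
    \<comment> \<open>The lost coordinate is recovered from membership: an element of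
      \<open>W'\<close> lies in exactly one of \<open>W\<close> and u + \<open>W\<close>, and in the
      latter case adding u once more returns to \<open>W\<close>.\<close>
    proof (rule bij_betw_byWitness[where f' = "\<lambda>(w, y). if w \<in> W then (w, y(\<beta> := 0))
        else (w + u, y(\<beta> := c))"])
      have not_in: "w + u \<notin> W" if "w \<in> W" for w
      proof
        assume "w + u \<in> W"
        then have "w + (w + u) \<in> W"
          using that less.prems by blast
        then show False
          using u double[of w] that less.prems by (auto simp: add.assoc[symmetric])
      qed
      show "\<forall>p\<in>W \<times> ({..<Suc \<beta>} \<rightarrow>\<^sub>E {0, c}). (\<lambda>(w, y). if w \<in> W then (w, y(\<beta> := 0))
        else (w + u, y(\<beta> := c))) (?q p) = p"
      proof (clarify, goal_cases)
        case (1 w y)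
        have y: "y \<beta> = 0 \<or> y \<beta> = c" "\<And>j. j > \<beta> \<Longrightarrow> y j = undefined"
          using 1 by (auto simp: PiE_iff extensional_def)
        then have "(restrict y {..<\<beta>})(\<beta> := y \<beta>) = y"
          by (auto simp: fun_eq_iff)
        note y' = this
        from y(1) show ?case
        proof
          assume "y \<beta> = 0"
          then show ?case
            using 1(1) y' by simp
        next
          assume "y \<beta> = c"
          then show ?case
            using 1(1) y' not_in[OF 1(1)] \<open>c \<noteq> 0\<close> by (simp add: uu')
        qed
      qed
      show "?q ` (W \<times> ({..<Suc \<beta>} \<rightarrow>\<^sub>E {0, c})) \<subseteq> W' \<times> ({..<\<beta>} \<rightarrow>\<^sub>E {0, c})"
      proof clarsimp
        fix w y assume wy: "w \<in> W" "y \<in> {..<Suc \<beta>} \<rightarrow>\<^sub>E {0, c}"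
        have "w \<in> W'" "w + u \<in> W'"
          using wy(1) by (auto simp: W'_def add.commute)
        then show "(y \<beta> = 0 \<longrightarrow> w \<in> W' \<and> y \<in> {..<\<beta>} \<rightarrow> {0, c}) \<and>
            (y \<beta> \<noteq> 0 \<longrightarrow> w + u \<in> W' \<and> y \<in> {..<\<beta>} \<rightarrow> {0, c})"
          using wy(2) by (auto simp: PiE_iff)
      qed
      have W'_cases: "w + u \<in> W" if "w \<in> W'" "w \<notin> W" for w
        using that by (auto simp: W'_def add.commute[of u] uu')
      show "(\<lambda>(w, y). if w \<in> W then (w, y(\<beta> := 0)) else (w + u, y(\<beta> := c))) `
          (W' \<times> ({..<\<beta>} \<rightarrow>\<^sub>E {0, c})) \<subseteq> W \<times> ({..<Suc \<beta>} \<rightarrow>\<^sub>E {0, c})"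
        using W'_cases by (auto simp: PiE_iff extensional_def less_Suc_eq split: if_splits)
      show "\<forall>p\<in>W' \<times> ({..<\<beta>} \<rightarrow>\<^sub>E {0, c}). ?q ((\<lambda>(w, y). if w \<in> W then (w, y(\<beta> := 0))
        else (w + u, y(\<beta> := c))) p) = p"
      proof (clarify, goal_cases)
        case (1 w y)
        have "restrict (y(\<beta> := d)) {..<\<beta>} = y" for d
          using 1 by (auto simp: PiE_iff extensional_def fun_eq_iff restrict_def)
        then show ?case
          using \<open>c \<noteq> 0\<close> by (simp add: uu')
      qed
    qed
    from bij_betw_trans[OF this bij] have "bij_betw ?F (W \<times> ({..<Suc \<beta>} \<rightarrow>\<^sub>E {0, c})) V"
      by (rule bij_betw_cong[THEN iffD1, rotated]) (simp only: F_eq o_apply)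
    then show ?thesis
      using v u by (intro exI[of _ "Suc \<beta>"] exI[of _ ?v]) auto
  qed
qed

context finite_dim_algebra
begin

lemma emb_mult_eq: "emb smul a * x = smul a x"
  using smul_mult[of a 1 x] by (simp add: emb_def)

text \<open>Coordinate vectors are extensional functions on an initial segment, matching the carrier
  of \<open>M20_pow\<close>; scalars enter through \<open>emb\<close>, matching the abstract
  embedding \<open>\<iota>\<close>.\<close>

lemma subspace_obtains_coordinates:
  assumes "subspace W"
  obtains b where "bij_betw (\<lambda>c. \<Sum>i<dim W. emb smul (c i) * b i) ({..<dim W} \<rightarrow>\<^sub>E UNIV) W"
proof -
  obtain Basis where "finite_dimensional_vector_space smul Basis"
    using finite_dim by blast
  then interpret fd: finite_dimensional_vector_space smul Basis .
  obtain B where B: "B \<subseteq> W" "independent B" "W \<subseteq> span B" "card B = dim W"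
    using basis_exists by blast
  have fin: "finite B"
    using fd.finiteI_independent B by blast
  have span: "span B = W"
    using B assms span_minimal by blast
  obtain b where b: "bij_betw b {..<dim W} B"
    using ex_bij_betw_nat_finite[OF fin] B(4) by (auto simp: atLeast0LessThan)
  let ?b' = "inv_into {..<dim W} b"
  let ?F = "\<lambda>c. \<Sum>i<dim W. smul (c i) (b i)"
  have F: "?F c = (\<Sum>v\<in>B. smul (c (?b' v)) v)" for c
    by (rule sum.reindex_bij_betw[OF bij_betw_inv_into[OF b], symmetric, THEN trans])
      (auto intro!: sum.cong simp: bij_betw_inv_into_right[OF b])
  have "bij_betw ?F ({..<dim W} \<rightarrow>\<^sub>E UNIV) W"
    unfolding bij_betw_def
  proof
    show "inj_on ?F ({..<dim W} \<rightarrow>\<^sub>E UNIV)"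
    proof (rule inj_onI)
      fix c c'
      assume c: "c \<in> {..<dim W} \<rightarrow>\<^sub>E UNIV" "c' \<in> {..<dim W} \<rightarrow>\<^sub>E UNIV" and "?F c = ?F c'"
      then have "(\<Sum>v\<in>B. smul (c (?b' v) - c' (?b' v)) v) = 0"
        by (simp add: F scale_left_diff_distrib sum_subtractf)
      then have *: "\<forall>v\<in>B. c (?b' v) - c' (?b' v) = 0"
        using B(2)[unfolded fd.independent_explicit, THEN conjunct2, rule_format,
          of "\<lambda>v. c (?b' v) - c' (?b' v)"] by blast
      have "c i = c' i" if "i < dim W" for i
      proof -
        have "b i \<in> B" "?b' (b i) = i"
          using b that by (auto simp: bij_betw_def)
        with * show ?thesis
          by fastforce
      qed
      then show "c = c'"
        using c by (intro PiE_ext) auto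
    qed
    show "?F ` ({..<dim W} \<rightarrow>\<^sub>E UNIV) = W"
    proof (intro equalityI subsetI)
      fix x assume "x \<in> ?F ` ({..<dim W} \<rightarrow>\<^sub>E UNIV)"
      then show "x \<in> W"
        using b B(1) by (auto intro!: subspace_sum[OF assms] subspace_scale[OF assms] simp: bij_betw_def)
    next
      fix x assume "x \<in> W"
      then obtain u where "x = (\<Sum>v\<in>B. smul (u v) v)"
        using span span_finite[OF fin] by auto
      then have "x = ?F (\<lambda>i\<in>{..<dim W}. u (b i))"
        unfolding F using b B(4)
        by (auto intro!: sum.cong simp: bij_betw_inv_into_right[OF b] bij_betw_def
          dest!: bij_betw_apply[OF bij_betw_inv_into[OF b]])
      then show "x \<in> ?F ` ({..<dim W} \<rightarrow>\<^sub>E UNIV)"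
        by (intro image_eqI[where f = ?F and x = "\<lambda>i\<in>{..<dim W}. u (b i)"]) simp_all
    qed
  qed
  then show ?thesis
    using that[of b] by (simp add: emb_mult_eq)
qed

end

section \<open>Matrices over a subspace as a direct sum of copies of M20\<close>

context square_zero_extension
begin

lemma lift_conj_mat:
  assumes "invertible g"
  shows "lift (conj_mat g A) = act g (lift A)"
proof -
  have "lift g ** lift (matrix_inv g) = mat 1" "lift (matrix_inv g) ** lift g = mat 1"
    by (simp_all add: lift_mult[symmetric] invertible_matrix_inv assms)
  then show ?thesis
    by (simp add: act_def conj_mat_def lift_mult matrix_inv_eqI)
qed

lemma act_mult_scalar: "act g (A ** mat x) = act g A ** mat x"
proof -
  have "B ** mat x = mat x ** B" for B :: "'t^2^2"
    by (simp add: mat_eq_iff_2 matrix_matrix_mult_def sum_2 mat_def mult.commute)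
  then have "lift g ** A ** (mat x ** matrix_inv (lift g)) = lift g ** A ** (matrix_inv (lift g) ** mat x)"
    by simp
  then show ?thesis
    unfolding act_def conj_mat_def by (simp only: matrix_mul_assoc)
qed

lemma act_sum: "act g (\<Sum>i\<in>S. A i) = (\<Sum>i\<in>S. act g (A i))"
  by (induction S rule: infinite_finite_induct) (simp_all add: act_add)

text \<open>In terms of tensor products, for a basis \<open>b\<close> of \<open>W\<close> this is
  the identification of M_2^0(k) \<otimes> W with the trace-zero matrices over \<open>W\<close>. Its
  equivariance rests on the matrices \<open>mat (b i)\<close> being central.\<close>

definition combine :: "nat \<Rightarrow> (nat \<Rightarrow> 't) \<Rightarrow> (nat \<Rightarrow> 'k^2^2) \<Rightarrow> 't^2^2" where
  "combine n b x = (\<Sum>i<n. lift (x i) ** mat (b i))"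

lemma combine_tz:
  "combine n b (\<lambda>i\<in>{..<n}. tz (h i) (e i) (f i)) =
    tz (\<Sum>i<n. \<iota> (h i) * b i) (\<Sum>i<n. \<iota> (e i) * b i) (\<Sum>i<n. \<iota> (f i) * b i)"
  unfolding combine_def sum_tz[symmetric]
  by (rule sum.cong) (simp_all add: tz_def mat_conv_mat2 \<iota>_uminus)

lemma combine_add:
  "combine n b (\<lambda>i\<in>{..<n}. x i + y i) = combine n b x + combine n b y"
  by (simp add: combine_def sum.distrib[symmetric] mat_eq_iff_2 matrix_matrix_mult_def sum_2 \<iota>_add
    algebra_simps)

lemma combine_conj:
  "invertible g \<Longrightarrow> combine n b (conj_tuple n g x) = act g (combine n b x)"
  by (simp add: combine_def conj_tuple_def act_sum act_mult_scalar lift_conj_mat)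

lemma M20_pow_carrier_obtains_tz:
  assumes "x \<in> {..<n} \<rightarrow>\<^sub>E carrier (M20 (UNIV :: 'k set))"
  obtains h e f where "h \<in> {..<n} \<rightarrow>\<^sub>E UNIV" "e \<in> {..<n} \<rightarrow>\<^sub>E UNIV" "f \<in> {..<n} \<rightarrow>\<^sub>E UNIV"
    "x = (\<lambda>i\<in>{..<n}. tz (h i) (e i) (f i))"
proof -
  have "\<exists>h e f. x i = tz h e f" if "i < n" for i
  proof -
    have "x i \<in> carrier (M20 UNIV)"
      using assms that by (simp add: PiE_iff)
    then show ?thesis
      by (rule M20_carrier_obtains_tz) blast
  qed
  then obtain h e f where "\<And>i. i < n \<Longrightarrow> x i = tz (h i) (e i) (f i)"
    by metis
  then have "x = (\<lambda>i\<in>{..<n}. tz (h i) (e i) (f i))"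
    using assms by (auto simp: fun_eq_iff PiE_iff extensional_def)
  then show ?thesis
    using that[of "restrict h {..<n}" "restrict e {..<n}" "restrict f {..<n}"]
    by (simp cong: restrict_cong)
qed

lemma bij_betw_combine:
  assumes b: "bij_betw (\<lambda>c. \<Sum>i<n. \<iota> (c i) * b i) ({..<n} \<rightarrow>\<^sub>E UNIV) W"
  shows "bij_betw (combine n b) ({..<n} \<rightarrow>\<^sub>E carrier (M20 UNIV)) {tz h e f |h e f. h \<in> W \<and> e \<in> W \<and> f \<in> W}"
    (is "bij_betw _ ?A ?B")
  unfolding bij_betw_def
proof
  let ?F = "\<lambda>c. \<Sum>i<n. \<iota> (c i) * b i"
  note inj = inj_onD[OF bij_betw_imp_inj_on[OF b]]
  show "inj_on (combine n b) ?A"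
  proof (rule inj_onI)
    fix x y assume xy: "x \<in> ?A" "y \<in> ?A" "combine n b x = combine n b y"
    obtain h e f where x: "h \<in> {..<n} \<rightarrow>\<^sub>E UNIV" "e \<in> {..<n} \<rightarrow>\<^sub>E UNIV" "f \<in> {..<n} \<rightarrow>\<^sub>E UNIV"
      "x = (\<lambda>i\<in>{..<n}. tz (h i) (e i) (f i))"
      by (rule M20_pow_carrier_obtains_tz[OF xy(1)])
    obtain h' e' f' where y: "h' \<in> {..<n} \<rightarrow>\<^sub>E UNIV" "e' \<in> {..<n} \<rightarrow>\<^sub>E UNIV" "f' \<in> {..<n} \<rightarrow>\<^sub>E UNIV"
      "y = (\<lambda>i\<in>{..<n}. tz (h' i) (e' i) (f' i))"
      by (rule M20_pow_carrier_obtains_tz[OF xy(2)])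
    have "?F h = ?F h'" "?F e = ?F e'" "?F f = ?F f'"
      using xy(3) unfolding x(4) y(4) combine_tz by auto
    then have "h = h'" "e = e'" "f = f'"
      using x(1-3) y(1-3) by (blast intro: inj)+
    then show "x = y"
      by (simp add: x y)
  qed
  have W: "?F c \<in> W" if "c \<in> {..<n} \<rightarrow>\<^sub>E UNIV" for c
    using bij_betw_apply[OF b that] .
  show "combine n b ` ?A = ?B"
  proof (intro equalityI subsetI)
    fix z assume "z \<in> combine n b ` ?A"
    then obtain x where "x \<in> ?A" "z = combine n b x"
      by blast
    then show "z \<in> ?B"
      using W by (elim M20_pow_carrier_obtains_tz) (auto simp: combine_tz)
  next
    fix z assume "z \<in> ?B"
    then obtain h e f where z: "z = tz h e f" "h \<in> W" "e \<in> W" "f \<in> W"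
      by blast
    have "\<exists>c. w = ?F c" if "w \<in> W" for w
      using that b by (auto simp: bij_betw_def)
    then obtain ch ce cf where "h = ?F ch" "e = ?F ce" "f = ?F cf"
      using z by metis
    then have "z = combine n b (\<lambda>i\<in>{..<n}. tz (ch i) (ce i) (cf i))"
      by (simp add: z combine_tz)
    moreover have "(\<lambda>i\<in>{..<n}. tz (ch i) (ce i) (cf i)) \<in> ?A"
      by (simp add: PiE_iff M20_carrier_mat2 tz_def)
    ultimately show "z \<in> combine n b ` ?A"
      by blast
  qed
qed

end

lemma M20_group:
  assumes "0 \<in> S" "\<And>x y. x \<in> S \<Longrightarrow> y \<in> S \<Longrightarrow> x + y \<in> S" "\<And>x. x \<in> S \<Longrightarrow> - x \<in> S"
  shows "group (M20 S)" "A \<in> carrier (M20 S) \<Longrightarrow> inv\<^bsub>M20 S\<^esub> A = - A"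
proof -
  have minus: "- A \<in> carrier (M20 S)" if "A \<in> carrier (M20 S)" for A
  proof -
    have "trace (- A) = - trace A"
      by (simp add: trace_def sum_negf)
    then show ?thesis
      using that assms(3) by (simp add: M20_carrier)
  qed
  have add: "A + B \<in> carrier (M20 S)" if "A \<in> carrier (M20 S)" "B \<in> carrier (M20 S)" for A B
    using that assms(2) by (simp add: M20_carrier trace_add)
  have zero: "0 \<in> carrier (M20 S)"
    using assms(1) by (simp add: M20_carrier trace_def)
  show *: "group (M20 S)"
  proof (rule groupI)
    fix A assume "A \<in> carrier (M20 S)"
    then show "\<exists>B\<in>carrier (M20 S). B \<otimes>\<^bsub>M20 S\<^esub> A = \<one>\<^bsub>M20 S\<^esub>"
      by (intro bexI[of _ "- A"]) (simp_all add: minus)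
  qed (simp_all add: add zero add.assoc)
  then show "inv\<^bsub>M20 S\<^esub> A = - A" if "A \<in> carrier (M20 S)"
    using group.inv_equality[OF *, of "- A" A] that minus by simp
qed

lemma product_group_mult: "x \<otimes>\<^bsub>product_group I G\<^esub> y = (\<lambda>i\<in>I. x i \<otimes>\<^bsub>G i\<^esub> y i)"
  by (simp add: product_group_def)

lemma carrier_mixed_module:
  "carrier (mixed_module \<alpha> \<beta> C) = ({..<\<alpha>} \<rightarrow>\<^sub>E carrier (M20 UNIV)) \<times> ({..<\<beta>} \<rightarrow>\<^sub>E C)"
  by (simp add: mixed_module_def M20_pow_def)

lemma mult_mixed_module:
  "(x, y) \<otimes>\<^bsub>mixed_module \<alpha> \<beta> C\<^esub> (x', y') = (\<lambda>i\<in>{..<\<alpha>}. x i + x' i, \<lambda>j\<in>{..<\<beta>}. y j + y' j)"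
  by (simp add: mixed_module_def M20_pow_def product_group_mult DirProd_def)

lemma conj_tuple_scalar:
  assumes "invertible g" "y \<in> {..<\<beta>} \<rightarrow>\<^sub>E C" "C \<subseteq> range mat"
  shows "conj_tuple \<beta> g y = y"
proof -
  have "conj_mat g (y j) = y j" if "j < \<beta>" for j
  proof -
    have "y j \<in> range mat"
      using assms that by (auto simp: PiE_iff)
    then show ?thesis
      using conj_mat_scalar[OF assms(1)] by auto
  qed
  then show ?thesis
    using assms(2) by (auto simp: conj_tuple_def fun_eq_iff PiE_iff extensional_def)
qed

lemma order_2_subgroup:
  fixes S :: "'a::comm_ring_1 set"
  assumes "subgroup C (M20 S)" "card C = 2"
  obtains c where "C = {0, c}" "c \<noteq> 0" "c + c = 0"
proof -
  have "0 \<in> C" and add: "\<And>x y. x \<in> C \<Longrightarrow> y \<in> C \<Longrightarrow> x + y \<in> C"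
    using subgroup.one_closed[OF assms(1)] subgroup.m_closed[OF assms(1)] by simp_all
  obtain a b where ab: "C = {a, b}" "a \<noteq> b"
    using assms(2) by (auto simp: card_2_iff)
  obtain c where c: "C = {0, c}" "c \<noteq> 0"
  proof (cases "a = 0")
    case True
    then show ?thesis
      using that[of b] ab by auto
  next
    case False
    then show ?thesis
      using that[of a] ab \<open>0 \<in> C\<close> by auto
  qed
  then show ?thesis
    using add[of c c] that by auto
qed

text \<open>The group acts trivially on scalars, so all two-element groups of scalars are isomorphic.\<close>

lemma mixed_module_iso:
  fixes C C' :: "('k::{field,finite}^2^2) set"
  assumes C: "subgroup C (M20 UNIV)" "C \<subseteq> range mat" "card C = 2"
    and C': "subgroup C' (M20 UNIV)" "C' \<subseteq> range mat" "card C' = 2"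
  shows "gmodule_iso (GL2 D) (mixed_module \<alpha> \<beta> C) (mixed_act \<alpha> \<beta>)
    (mixed_module \<alpha> \<beta> C') (mixed_act \<alpha> \<beta>)"
proof -
  obtain c where c: "C = {0, c}" "c \<noteq> 0" "c + c = 0"
    using order_2_subgroup[OF C(1,3)] by blast
  obtain c' where c': "C' = {0, c'}" "c' \<noteq> 0" "c' + c' = 0"
    using order_2_subgroup[OF C'(1,3)] by blast
  \<comment> \<open>In each coordinate this is the only isomorphism between two groups of order two,
    so \<open>swap c\<close> and \<open>swap c'\<close> invert each other.\<close>
  define swap :: "'k^2^2 \<Rightarrow> (nat \<Rightarrow> 'k^2^2) \<Rightarrow> nat \<Rightarrow> 'k^2^2" where
    "swap z y = (\<lambda>j\<in>{..<\<beta>}. if y j = 0 then 0 else z)" for z y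
  have swap_mem: "swap z y \<in> {..<\<beta>} \<rightarrow>\<^sub>E {0, z}" for z y
    unfolding swap_def by (rule restrict_PiE_iff[THEN iffD2]) simp
  have swap_swap: "swap z (swap z' y) = y" if y: "y \<in> {..<\<beta>} \<rightarrow>\<^sub>E {0, z}" and "z' \<noteq> 0" for z z' y
  proof (rule PiE_ext[OF swap_mem y])
    fix j assume j: "j \<in> {..<\<beta>}"
    then have "y j = 0 \<or> y j = z"
      using PiE_mem[OF y j] by simp
    then show "swap z (swap z' y) j = y j"
      using j \<open>z' \<noteq> 0\<close> by (auto simp: swap_def)
  qed
  let ?\<phi> = "swap c'"
  have "bij_betw ?\<phi> ({..<\<beta>} \<rightarrow>\<^sub>E C) ({..<\<beta>} \<rightarrow>\<^sub>E C')"
    unfolding c(1) c'(1)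
  proof (rule bij_betw_byWitness)
    show "\<forall>y\<in>{..<\<beta>} \<rightarrow>\<^sub>E {0, c}. swap c (swap c' y) = y"
      by (intro ballI swap_swap c'(2))
    show "\<forall>y\<in>{..<\<beta>} \<rightarrow>\<^sub>E {0, c'}. swap c' (swap c y) = y"
      by (intro ballI swap_swap c(2))
  qed (intro image_subsetI swap_mem)+
  then have bij: "bij_betw (map_prod id ?\<phi>) (carrier (mixed_module \<alpha> \<beta> C)) (carrier (mixed_module \<alpha> \<beta> C'))"
    unfolding carrier_mixed_module by (intro bij_betw_map_prod) simp_all
  have "map_prod id ?\<phi> (p \<otimes>\<^bsub>mixed_module \<alpha> \<beta> C\<^esub> p') =
      map_prod id ?\<phi> p \<otimes>\<^bsub>mixed_module \<alpha> \<beta> C'\<^esub> map_prod id ?\<phi> p'"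
    if p: "p \<in> carrier (mixed_module \<alpha> \<beta> C)" "p' \<in> carrier (mixed_module \<alpha> \<beta> C)" for p p'
  proof -
    obtain x y x' y' where eq: "p = (x, y)" "p' = (x', y')"
      by (cases p, cases p')
    have "?\<phi> (\<lambda>j\<in>{..<\<beta>}. y j + y' j) = (\<lambda>j\<in>{..<\<beta>}. ?\<phi> y j + ?\<phi> y' j)"
      unfolding swap_def
    proof (rule restrict_ext)
      fix j assume j: "j \<in> {..<\<beta>}"
      then have "y j \<in> {0, c}" "y' j \<in> {0, c}"
        using p unfolding eq carrier_mixed_module c(1) by blast+
      then show "(if (\<lambda>j\<in>{..<\<beta>}. y j + y' j) j = 0 then 0 else c') =
          (\<lambda>j\<in>{..<\<beta>}. if y j = 0 then 0 else c') j + (\<lambda>j\<in>{..<\<beta>}. if y' j = 0 then 0 else c') j"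
        using j c(2,3) c'(3) by (elim insertE emptyE) simp_all
    qed
    then show ?thesis
      by (simp add: eq mult_mixed_module)
  qed
  then have "map_prod id ?\<phi> \<in> iso (mixed_module \<alpha> \<beta> C) (mixed_module \<alpha> \<beta> C')"
    unfolding iso_def hom_def using bij bij_betw_apply[OF bij] by blast
  moreover have "map_prod id ?\<phi> (mixed_act \<alpha> \<beta> g p) = mixed_act \<alpha> \<beta> g (map_prod id ?\<phi> p)"
    if g: "g \<in> carrier (GL2 D)" and p: "p \<in> carrier (mixed_module \<alpha> \<beta> C)" for g p
  proof -
    obtain x y where eq: "p = (x, y)"
      by (cases p)
    have "invertible g"
      using g by (simp add: GL2_def)
    moreover have "y \<in> {..<\<beta>} \<rightarrow>\<^sub>E C" "?\<phi> y \<in> {..<\<beta>} \<rightarrow>\<^sub>E C'"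
      using p bij_betw_apply[OF bij p] by (auto simp: eq carrier_mixed_module)
    ultimately show ?thesis
      using C(2) C'(2) by (simp add: eq mixed_act_def conj_tuple_scalar)
  qed
  ultimately show ?thesis
    unfolding gmodule_iso_def by blast
qed

text \<open>If \<alpha> < \<alpha>', cancelling \<open>q ^ \<alpha>\<close> leaves an even cofactor
  (q - 1) 2^\<beta> + 1, so \<beta> = 0 and the cofactor is q itself. Cancelling this q as well
  leaves 1 on one side and a multiple of a cofactor greater than 1 on the other.\<close>

lemma power_mult_odd_inj:
  fixes q \<alpha> \<beta> \<alpha>' \<beta>' :: nat
  assumes "even q" "q > 2" "q ^ \<alpha> * ((q - 1) * 2 ^ \<beta> + 1) = q ^ \<alpha>' * ((q - 1) * 2 ^ \<beta>' + 1)"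
  shows "\<alpha> = \<alpha>' \<and> \<beta> = \<beta>'"
proof -
  have not_less: False if less: "\<alpha> < \<alpha>'"
    and eq: "q ^ \<alpha> * ((q - 1) * 2 ^ \<beta> + 1) = q ^ \<alpha>' * ((q - 1) * 2 ^ \<beta>' + 1)" for \<alpha> \<beta> \<alpha>' \<beta>'
  proof -
    define n where "n = \<alpha>' - \<alpha> - 1"
    have "\<alpha>' = \<alpha> + Suc n"
      using less by (simp add: n_def)
    then have "q ^ \<alpha> * ((q - 1) * 2 ^ \<beta> + 1) = q ^ \<alpha> * (q * (q ^ n * ((q - 1) * 2 ^ \<beta>' + 1)))"
      using eq by (simp only: power_add power_Suc mult.assoc)
    then have *: "(q - 1) * 2 ^ \<beta> + 1 = q * (q ^ n * ((q - 1) * 2 ^ \<beta>' + 1))"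
      using \<open>q > 2\<close> by (simp only: mult_cancel1) auto
    then have "even ((q - 1) * 2 ^ \<beta> + 1)"
      using \<open>even q\<close> by simp
    then have "\<beta> = 0"
      by (cases \<beta>) auto
    with * have "q * 1 = q * (q ^ n * ((q - 1) * 2 ^ \<beta>' + 1))"
      using \<open>q > 2\<close> by simp
    then have "q ^ n * ((q - 1) * 2 ^ \<beta>' + 1) = 1"
      using \<open>q > 2\<close> by (simp only: mult_cancel1) auto
    then have "(q - 1) * 2 ^ \<beta>' + 1 = 1"
      by (simp only: nat_mult_eq_1_iff)
    then show False
      using \<open>q > 2\<close> by simp
  qed
  then have "\<alpha> = \<alpha>'"
    using assms(3) by (metis linorder_neqE_nat)
  moreover have "\<beta> = \<beta>'"
    using assms by (simp add: \<open>\<alpha> = \<alpha>'\<close>)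
  ultimately show ?thesis
    by simp
qed

text \<open>Equal trace numbers give equal \<alpha> and \<beta>, so both modules are compared with
  mixed modules of the same shape, which do not depend on the chosen group of order two.\<close>

lemma describes_image_unique:
  fixes smul :: "'k::{field,finite} \<Rightarrow> 't::comm_ring_1 \<Rightarrow> 't"
    and smul' :: "'k \<Rightarrow> 't2::comm_ring_1 \<Rightarrow> 't2"
  assumes "even CARD('k)" "CARD('k) > 2"
    and M: "describes_image smul mT \<Gamma> \<rho> D d \<alpha> \<beta> M"
    and M': "describes_image smul' mT' \<Gamma>' \<rho>' D d \<alpha>' \<beta>' M'"
    and t: "num_traces \<Gamma>' \<rho>' = num_traces \<Gamma> \<rho>"
  shows "gmodule_iso (GL2 D) ((M20 mT)\<lparr>carrier := M\<rparr>) (emb_conj smul)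
    ((M20 mT')\<lparr>carrier := M'\<rparr>) (emb_conj smul')"
proof -
  have "\<alpha>' = \<alpha> \<and> \<beta>' = \<beta>"
    by (rule power_mult_odd_inj[OF assms(1,2)])
      (use M M' t in \<open>unfold describes_image_def, simp\<close>)
  then have eq: "\<alpha>' = \<alpha>" "\<beta>' = \<beta>"
    by auto
  obtain C where C: "subgroup C (M20 (UNIV :: 'k set))" "C \<subseteq> range mat" "card C = 2"
    and iso: "gmodule_iso (GL2 D) ((M20 mT)\<lparr>carrier := M\<rparr>) (emb_conj smul)
      (mixed_module \<alpha> \<beta> C) (mixed_act \<alpha> \<beta>)"
    using M unfolding describes_image_def by blast
  obtain C' where C': "subgroup C' (M20 (UNIV :: 'k set))" "C' \<subseteq> range mat" "card C' = 2"
    and iso': "gmodule_iso (GL2 D) ((M20 mT')\<lparr>carrier := M'\<rparr>) (emb_conj smul')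
      (mixed_module \<alpha> \<beta> C') (mixed_act \<alpha> \<beta>)"
    using M' unfolding describes_image_def eq by blast
  have sub: "subgroup M' (M20 mT')" "\<And>g x. g \<in> carrier (GL2 D) \<Longrightarrow> x \<in> M' \<Longrightarrow> emb_conj smul' g x \<in> M'"
    using M' by (auto simp: describes_image_def gsubmodule_def)
  have "gmodule_iso (GL2 D) (mixed_module \<alpha> \<beta> C') (mixed_act \<alpha> \<beta>)
      ((M20 mT')\<lparr>carrier := M'\<rparr>) (emb_conj smul')"
    by (rule gmodule_iso_sym[OF iso']) (use subgroup.m_closed[OF sub(1)] sub(2) in auto)
  then show ?thesis
    using gmodule_iso_trans[OF gmodule_iso_trans[OF iso mixed_module_iso[OF C C']]] by blast
qed

context square_zero_extension
begin

lemma M20_pow_gmodule_iso: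
  assumes b: "bij_betw (\<lambda>c. \<Sum>i<n. \<iota> (c i) * b i) ({..<n} \<rightarrow>\<^sub>E UNIV) W"
  shows "gmodule_iso (GL2 D) (M20_pow n) (conj_tuple n)
    ((M20 m)\<lparr>carrier := {tz h e f |h e f. h \<in> W \<and> e \<in> W \<and> f \<in> W}\<rparr>) act"
proof -
  note bij = bij_betw_combine[OF b]
  have "combine n b \<in> iso (M20_pow n) ((M20 m)\<lparr>carrier := {tz h e f |h e f. h \<in> W \<and> e \<in> W \<and> f \<in> W}\<rparr>)"
    unfolding iso_def hom_def
    using bij bij_betw_apply[OF bij] by (auto simp: M20_pow_def product_group_mult combine_add)
  then show ?thesis
    unfolding gmodule_iso_def by (rule bexI[rotated]) (simp add: GL2_def combine_conj)
qed

lemma mat_conv_tz: "x + x = 0 \<Longrightarrow> mat x = tz x 0 0"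
  by (simp add: mat_conv_mat2 tz_def eq_neg_iff_add_eq_0)

text \<open>The matrices \<open>tz (s y) 0 0\<close> are scalar in characteristic 2, so the
  generators of \<open>V\<close> over \<open>W\<close> span a summand with trivial action.
  Additivity of \<open>s\<close> reflects that a generator occurring twice cancels, just as
  \<open>mat 1\<close> does.\<close>

lemma mixed_module_gmodule_iso:
  assumes b: "bij_betw (\<lambda>c. \<Sum>i<n. \<iota> (c i) * b i) ({..<n} \<rightarrow>\<^sub>E UNIV) W"
    and v: "bij_betw (\<lambda>(w, y). w + (\<Sum>j<\<beta>. if y j = 0 then 0 else v j)) (W \<times> ({..<\<beta>} \<rightarrow>\<^sub>E {0, mat 1 :: 'k^2^2})) V"
    and two: "(2::'k) = 0"
  shows "gmodule_iso (GL2 D) (mixed_module n \<beta> {0, mat 1}) (mixed_act n \<beta>)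
    ((M20 m)\<lparr>carrier := {tz h e f |h e f. h \<in> V \<and> e \<in> W \<and> f \<in> W}\<rparr>) act"
proof -
  note bij = bij_betw_combine[OF b]
  have double: "x + x = 0" for x :: 't
  proof -
    have "(2::'t) = 0"
      using \<iota>_2 two by simp
    then show ?thesis
      by (metis mult_2 mult_zero_left)
  qed
  define s :: "(nat \<Rightarrow> 'k^2^2) \<Rightarrow> 't" where "s y = (\<Sum>j<\<beta>. if y j = 0 then 0 else v j)" for y
  define F where "F = (\<lambda>(x, y). combine n b x + tz (s y) 0 0)"
  let ?A = "{..<n} \<rightarrow>\<^sub>E carrier (M20 (UNIV :: 'k set))" and ?Y = "{..<\<beta>} \<rightarrow>\<^sub>E {0, mat 1 :: 'k^2^2}"
  let ?M = "{tz h e f |h e f. h \<in> V \<and> e \<in> W \<and> f \<in> W}"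
  have v': "bij_betw (\<lambda>(w, y). w + s y) (W \<times> ?Y) V"
    using v by (simp add: s_def)
  have C: "{0, mat 1 :: 'k^2^2} \<subseteq> range mat"
    unfolding mat_0[symmetric] by blast
  have "bij_betw F (?A \<times> ?Y) ?M"
    unfolding bij_betw_def
  proof
    show "inj_on F (?A \<times> ?Y)"
    proof (rule inj_onI, clarify)
      fix x y x' y' assume x: "x \<in> ?A" "x' \<in> ?A" and y: "y \<in> ?Y" "y' \<in> ?Y" and eq: "F (x, y) = F (x', y')"
      obtain h e f where 1: "combine n b x = tz h e f" "h \<in> W" "e \<in> W" "f \<in> W"
        using bij_betw_apply[OF bij x(1)] by blast
      obtain h' e' f' where 2: "combine n b x' = tz h' e' f'" "h' \<in> W" "e' \<in> W" "f' \<in> W"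
        using bij_betw_apply[OF bij x(2)] by blast
      have "h + s y = h' + s y'" "e = e'" "f = f'"
        using eq by (simp_all add: F_def 1 2)
      moreover from this(1) have "(h, y) = (h', y')"
        using 1 2 y by (intro inj_onD[OF bij_betw_imp_inj_on[OF v']]) auto
      ultimately show "x = x' \<and> y = y'"
        using 1 2 inj_onD[OF bij_betw_imp_inj_on[OF bij], of x x'] x by simp
    qed
    show "F ` (?A \<times> ?Y) = ?M"
    proof (intro equalityI subsetI)
      fix z assume "z \<in> F ` (?A \<times> ?Y)"
      then obtain x y where z: "z = F (x, y)" "x \<in> ?A" "y \<in> ?Y"
        by blast
      obtain h e f where 1: "combine n b x = tz h e f" "h \<in> W" "e \<in> W" "f \<in> W"
        using bij_betw_apply[OF bij z(2)] by blast
      have "h + s y \<in> V"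
        using bij_betw_apply[OF v', of "(h, y)"] 1 z by simp
      then show "z \<in> ?M"
        using 1 by (auto simp: z F_def)
    next
      fix z assume "z \<in> ?M"
      then obtain h e f where z: "z = tz h e f" "h \<in> V" "e \<in> W" "f \<in> W"
        by blast
      obtain w y where w: "h = w + s y" "w \<in> W" "y \<in> ?Y"
        using z(2) bij_betw_imp_surj_on[OF v'] by auto
      have "tz w e f \<in> combine n b ` ?A"
        using z w bij_betw_imp_surj_on[OF bij] by blast
      then obtain x where "x \<in> ?A" "combine n b x = tz w e f"
        by auto
      then show "z \<in> F ` (?A \<times> ?Y)"
        using w z by (intro image_eqI[where f = F and x = "(x, y)"]) (simp_all add: F_def)
    qed
  qed
  then have bijF: "bij_betw F (carrier (mixed_module n \<beta> {0, mat 1})) ?M"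
    by (simp add: carrier_mixed_module)
  have "F (p \<otimes>\<^bsub>mixed_module n \<beta> {0, mat 1}\<^esub> p') = F p + F p'"
    if p: "p \<in> carrier (mixed_module n \<beta> {0, mat 1})" "p' \<in> carrier (mixed_module n \<beta> {0, mat 1})" for p p'
  proof -
    obtain x y x' y' where eq: "p = (x, y)" "p' = (x', y')"
      by (cases p, cases p')
    have *: "mat 1 + mat 1 = (0 :: 'k^2^2)" "mat 1 \<noteq> (0 :: 'k^2^2)"
      using two by (simp_all add: mat_conv_mat2 zero_conv_mat2)
    have "(if y j + y' j = 0 then 0 else v j) = (if y j = 0 then 0 else v j) + (if y' j = 0 then 0 else v j)"
      if "j < \<beta>" for j
    proof -
      have "y j = 0 \<or> y j = mat 1" "y' j = 0 \<or> y' j = mat 1"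
        using p that by (auto simp: eq carrier_mixed_module PiE_iff)
      then show ?thesis
        using * double[of "v j"] by auto
    qed
    then have "s (\<lambda>j\<in>{..<\<beta>}. y j + y' j) = s y + s y'"
      by (simp add: s_def sum.distrib[symmetric])
    then show ?thesis
      by (simp add: eq mult_mixed_module F_def combine_add)
  qed
  then have "F \<in> iso (mixed_module n \<beta> {0, mat 1}) ((M20 m)\<lparr>carrier := ?M\<rparr>)"
    unfolding iso_def hom_def using bijF bij_betw_apply[OF bijF] by simp
  moreover have "F (mixed_act n \<beta> g p) = act g (F p)"
    if g: "g \<in> carrier (GL2 D)" and p: "p \<in> carrier (mixed_module n \<beta> {0, mat 1})" for g p
  proof -
    obtain x y where eq: "p = (x, y)"
      by (cases p)
    have "y \<in> ?Y"
      using p by (simp add: eq carrier_mixed_module)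
    then have "conj_tuple \<beta> g y = y"
      using conj_tuple_scalar[OF GL2_invertible[OF g] _ C] by blast
    moreover have "act g (tz (s y) 0 0) = tz (s y) 0 0"
      unfolding mat_conv_tz[OF double, symmetric] act_def
      by (rule conj_mat_scalar[OF GL2_invertible_lift[OF g]])
    ultimately show ?thesis
      by (simp add: eq mixed_act_def F_def act_add combine_conj GL2_invertible[OF g])
  qed
  ultimately show ?thesis
    unfolding gmodule_iso_def by blast
qed

end

section \<open>The image of the representation\<close>

text \<open>Here \<open>G\<close> stands for the image of the representation and
  \<open>\<pi>\<close> for the residue map; ideals and quotient rings stay outside the matrix
  computations.\<close>

locale lifted_image = square_zero_extension \<iota> m
  for \<iota> :: "'k::{field,finite} \<Rightarrow> 't::comm_ring_1" and m :: "'t set" +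
  fixes \<pi> :: "'t \<Rightarrow> 'k" and D :: "'k set" and G :: "('t^2^2) set"
  assumes \<pi>_add: "\<pi> (x + y) = \<pi> x + \<pi> y"
    and \<pi>_mult: "\<pi> (x * y) = \<pi> x * \<pi> y"
    and \<pi>_\<iota>: "\<pi> (\<iota> a) = a"
    and \<pi>_eq_0_iff: "\<pi> x = 0 \<longleftrightarrow> x \<in> m"
    and card_k: "CARD('k) > 3" "(2::'k) \<noteq> 0 \<Longrightarrow> CARD('k) > 5"
    and G_mult: "A \<in> G \<Longrightarrow> B \<in> G \<Longrightarrow> A ** B \<in> G"
    and G_inverse: "A \<in> G \<Longrightarrow> \<exists>B\<in>G. A ** B = mat 1 \<and> B ** A = mat 1"
    and G_det: "A \<in> G \<Longrightarrow> det A \<in> \<iota> ` D"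
    and G_residue: "map_matrix \<pi> ` G = carrier (GL2 D)"
    and one_D: "1 \<in> D"
begin

lemma \<pi>_0 [simp]: "\<pi> 0 = 0"
  by (simp add: \<pi>_eq_0_iff)

lemma \<pi>_1 [simp]: "\<pi> 1 = 1"
  using \<pi>_\<iota>[of 1] by simp

lemma \<pi>_diff: "\<pi> (x - y) = \<pi> x - \<pi> y"
  using \<pi>_add[of "x - y" y] by (simp add: eq_diff_eq)

lemma residue_mult: "map_matrix \<pi> (A ** B) = map_matrix \<pi> A ** map_matrix \<pi> (B :: 't^2^2)"
  by (simp add: vec_eq_iff matrix_matrix_mult_def sum_2 \<pi>_add \<pi>_mult)

lemma residue_lift: "map_matrix \<pi> (lift g) = g"
  by (simp add: vec_eq_iff \<pi>_\<iota>)

lemma residue_one: "map_matrix \<pi> (mat 1 :: 't^2^2) = mat 1"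
  by (simp add: mat_conv_mat2)

lemma residue_one_plus:
  fixes A :: "'t^2^2"
  assumes "\<And>i j. A $ i $ j \<in> m"
  shows "map_matrix \<pi> (mat 1 + A) = mat 1"
  using assms by (simp add: vec_eq_iff \<pi>_add \<pi>_eq_0_iff[THEN iffD2] mat_def)

lemma matrix_mult_m_eq_0:
  fixes A B :: "'t^2^2"
  assumes "\<And>i j. A $ i $ j \<in> m" "\<And>i j. B $ i $ j \<in> m"
  shows "A ** B = 0"
  using assms by (simp add: vec_eq_iff matrix_matrix_mult_def m_square)

lemma one_plus_mult:
  fixes A B :: "'t^2^2"
  assumes "\<And>i j. A $ i $ j \<in> m" "\<And>i j. B $ i $ j \<in> m"
  shows "(mat 1 + A) ** (mat 1 + B) = mat 1 + (A + B)"
proof -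
  have "(mat 1 + A) ** (mat 1 + B) = mat 1 + (A + B) + A ** B"
    by (simp add: matrix_add_ldistrib matrix_add_rdistrib add_ac)
  then show ?thesis
    by (simp add: matrix_mult_m_eq_0 assms)
qed

lemma lift_mult_right:
  assumes "invertible g"
  shows "lift g ** A = act g A ** lift g"
  by (simp add: act_def conj_mat_def matrix_mul_assoc[symmetric]
    invertible_matrix_inv[OF invertible_lift[OF assms]])

text \<open>Matrices 1 + A with entries of A in m multiply by adding the A, since m squares to zero.
  In the coordinates (A, g) the group law is therefore that of a semidirect product, and closure of
  \<open>G\<close> becomes the cocycle identity.\<close>

lemma one_plus_lift_mult:
  assumes "invertible g" "\<And>i j. A $ i $ j \<in> m" "\<And>i j. B $ i $ j \<in> m"
  shows "((mat 1 + A) ** lift g) ** ((mat 1 + B) ** lift h) = (mat 1 + (A + act g B)) ** lift (g ** h)"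
proof -
  have "lift g ** (mat 1 + B) = (mat 1 + act g B) ** lift g"
    by (simp add: matrix_add_ldistrib matrix_add_rdistrib lift_mult_right[OF assms(1)])
  then have "(mat 1 + A) ** (lift g ** (mat 1 + B)) ** lift h =
      (mat 1 + A) ** ((mat 1 + act g B) ** lift g) ** lift h"
    by simp
  then have "((mat 1 + A) ** lift g) ** ((mat 1 + B) ** lift h) =
      ((mat 1 + A) ** (mat 1 + act g B)) ** lift (g ** h)"
    by (simp only: matrix_mul_assoc lift_mult)
  then show ?thesis
    using one_plus_mult[OF assms(2) act_entries_in_m[OF assms(3)]] by simp
qed

lemma M20_entries: "A \<in> carrier (M20 m) \<Longrightarrow> A $ i $ j \<in> m"
  by (simp add: M20_carrier)

definition R :: "'k^2^2 \<Rightarrow> 't^2^2 \<Rightarrow> bool" where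
  "R g A \<longleftrightarrow> g \<in> carrier (GL2 D) \<and> A \<in> carrier (M20 m) \<and> (mat 1 + A) ** lift g \<in> G"

lemma residue_R: "R g A \<Longrightarrow> map_matrix \<pi> ((mat 1 + A) ** lift g) = g"
  using residue_one_plus[OF M20_entries, of A] by (simp add: R_def residue_mult residue_lift)

lemma det_one_plus:
  fixes A :: "'t^2^2"
  assumes "\<And>i j. A $ i $ j \<in> m"
  shows "det (mat 1 + A) = 1 + trace A"
  using assms by (simp add: det_2 trace_def sum_2 mat_def algebra_simps m_square)

text \<open>The determinant condition is what makes \<open>A\<close> trace-zero: (1 + trace A)
  \<iota>(det g) lies in the image of \<open>\<iota>\<close>, its residue is det g, and hence trace
  A times a unit vanishes.\<close>

lemma lift_decomposition:
  assumes g: "map_matrix \<pi> B \<in> carrier (GL2 D)" and det: "det B \<in> \<iota> ` D"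
  obtains A where "A \<in> carrier (M20 m)" "B = (mat 1 + A) ** lift (map_matrix \<pi> B)"
proof -
  define g where "g = map_matrix \<pi> B"
  note g = assms(1)[folded g_def]
  note inv = invertible_matrix_inv[OF GL2_invertible[OF g]]
  define A where "A = B ** lift (matrix_inv g) - mat 1"
  have "map_matrix \<pi> (B ** lift (matrix_inv g)) = mat 1"
    by (simp add: residue_mult residue_lift inv flip: g_def)
  then have "\<pi> ((B ** lift (matrix_inv g)) $ i $ j) = \<pi> (mat 1 $ i $ j)" for i j
    using residue_one by (metis nth_map_matrix)
  then have entries: "A $ i $ j \<in> m" for i j
    by (simp add: A_def \<pi>_eq_0_iff[symmetric] \<pi>_diff)
  have B: "(mat 1 + A) ** lift g = B"
    by (simp add: A_def matrix_mul_assoc[symmetric] lift_mult[symmetric] inv)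
  obtain \<delta> where \<delta>: "det B = \<iota> \<delta>"
    using det by blast
  have d: "(1 + trace A) * \<iota> (det g) = \<iota> \<delta>"
    using arg_cong[OF B, of det] by (simp add: det_mul det_one_plus[OF entries] det_lift \<delta>)
  have "trace A \<in> m"
    using entries by (simp add: trace_def sum_2 m_add)
  then have "det g = \<delta>"
    using arg_cong[OF d, of \<pi>] by (simp add: \<pi>_mult \<pi>_\<iota> \<pi>_add \<pi>_eq_0_iff[THEN iffD2])
  then have "\<iota> (inverse \<delta>) * (\<iota> \<delta> * trace A) = 0"
    using d by (simp add: algebra_simps)
  moreover have "\<delta> \<noteq> 0"
    using g \<open>det g = \<delta>\<close> by (simp add: GL2_carrier_field)
  ultimately have "trace A = 0"
    by (simp add: \<iota>_inverse_cancel)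
  then have "A \<in> carrier (M20 m)"
    using entries by (simp add: M20_carrier)
  then show ?thesis
    using that B by (simp add: g_def)
qed

lemma R_of_mem_G:
  assumes "B \<in> G"
  obtains g A where "R g A" "B = (mat 1 + A) ** lift g"
proof -
  have g: "map_matrix \<pi> B \<in> carrier (GL2 D)"
    using assms G_residue by blast
  obtain A where "A \<in> carrier (M20 m)" "B = (mat 1 + A) ** lift (map_matrix \<pi> B)"
    using lift_decomposition[OF g G_det[OF assms]] by blast
  then show ?thesis
    using that[of "map_matrix \<pi> B" A] g assms by (simp add: R_def)
qed

sublocale cocycle_rel \<iota> m D R
proof
  show "R g A \<Longrightarrow> g \<in> carrier (GL2 D) \<and> A \<in> carrier (M20 m)" for g A
    by (simp add: R_def)
  show "\<exists>A. R g A" if g: "g \<in> carrier (GL2 D)" for g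
  proof -
    obtain B where "B \<in> G" "g = map_matrix \<pi> B"
      using g unfolding G_residue[symmetric] by blast
    moreover obtain g' A where "R g' A" "B = (mat 1 + A) ** lift g'"
      using R_of_mem_G[OF \<open>B \<in> G\<close>] by blast
    ultimately show ?thesis
      using residue_R by auto
  qed
  show "R (g ** h) (A + act g B)" if R: "R g A" "R h B" for g A h B
  proof -
    have inv: "invertible g"
      using R by (auto simp: R_def intro: GL2_invertible)
    have "((mat 1 + A) ** lift g) ** ((mat 1 + B) ** lift h) \<in> G"
      using R by (auto simp: R_def intro: G_mult)
    then have *: "(mat 1 + (A + act g B)) ** lift (g ** h) \<in> G"
      using R one_plus_lift_mult[OF inv, of A B h] by (simp add: R_def M20_entries)
    have M: "A + act g B \<in> carrier (M20 m)"
      using R inv by (auto simp: R_def intro: M20_add act_M20)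
    have "map_matrix \<pi> ((mat 1 + (A + act g B)) ** lift (g ** h)) = g ** h"
      using residue_one_plus[OF M20_entries[OF M]] by (simp add: residue_mult residue_lift)
    then have "g ** h \<in> carrier (GL2 D)"
      using * G_residue by (metis imageI)
    then show ?thesis
      using * M by (simp add: R_def)
  qed
  show "R (mat 1) (A - B)" if R: "R g A" "R g B" for g A B
  proof -
    have inv: "invertible g"
      using R by (auto simp: R_def intro: GL2_invertible)
    note g_inv = invertible_matrix_inv[OF inv]
    have M: "A \<in> carrier (M20 m)" "B \<in> carrier (M20 m)" "A - B \<in> carrier (M20 m)"
      using R by (auto simp: R_def intro: M20_diff)
    obtain C where C: "C \<in> G" "((mat 1 + B) ** lift g) ** C = mat 1"
      using G_inverse[of "(mat 1 + B) ** lift g"] R by (auto simp: R_def)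
    have "(mat 1 + A) ** lift g = (mat 1 + (A - B)) ** ((mat 1 + B) ** lift g)"
      using one_plus_mult[OF M20_entries[OF M(3)] M20_entries[OF M(2)]] by (simp add: matrix_mul_assoc)
    then have "((mat 1 + A) ** lift g) ** C = mat 1 + (A - B)"
      by (simp add: matrix_mul_assoc[symmetric] C(2)[unfolded matrix_mul_assoc[symmetric]])
    moreover have "((mat 1 + A) ** lift g) ** C \<in> G"
      using R C by (auto simp: R_def intro: G_mult)
    moreover have "mat 1 \<in> carrier (GL2 D)"
      using one_D by (simp add: GL2_carrier_field)
    ultimately show ?thesis
      using M by (simp add: R_def)
  qed
qed (use card_k one_D in auto)

definition M :: "('t^2^2) set" where
  "M = {tz h e f |h e f. h \<in> V \<and> e \<in> W \<and> f \<in> W}"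

lemma tz_in_M_iff: "tz h e f \<in> M \<longleftrightarrow> h \<in> V \<and> e \<in> W \<and> f \<in> W"
  by (simp add: M_def)

lemma R_one_iff: "R (mat 1) A \<longleftrightarrow> A \<in> M"
proof
  assume R: "R (mat 1) A"
  obtain h e f where A: "A = tz h e f"
    using M20_carrier_obtains_tz[OF conjunct2[OF R_carrier[OF R]]] by metis
  then show "A \<in> M"
    using R by (simp add: R_one_tz_iff tz_in_M_iff)
next
  assume "A \<in> M"
  then obtain h e f where "A = tz h e f" "h \<in> V" "e \<in> W" "f \<in> W"
    unfolding M_def by blast
  then show "R (mat 1) A"
    by (simp add: R_one_tz_iff)
qed

lemma M_subset: "M \<subseteq> carrier (M20 m)"
  using R_carrier R_one_iff by blast

lemma gsubmodule_M: "gsubmodule (GL2 D) (M20 m) act M"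
proof -
  have M20: "group (M20 m)" "\<And>A. A \<in> carrier (M20 m) \<Longrightarrow> inv\<^bsub>M20 m\<^esub> A = - A"
    by (auto intro!: M20_group m_add m_uminus)
  have "subgroup M (M20 m)"
  proof (rule group.subgroupI[OF M20(1)])
    show "M \<noteq> {}"
      using R_one_zero R_one_iff by blast
    show "inv\<^bsub>M20 m\<^esub> A \<in> M" if "A \<in> M" for A
      using that M_subset R_one_uminus[of A] by (simp add: M20(2) R_one_iff subset_iff)
    show "A \<otimes>\<^bsub>M20 m\<^esub> B \<in> M" if "A \<in> M" "B \<in> M" for A B
      using that R_one_add_left[of A "mat 1" B] by (simp add: R_one_iff)
  qed (rule M_subset)
  then show ?thesis
    using R_one_act by (simp add: gsubmodule_def R_one_iff)
qed

text \<open>Two values at g differ by an element of the kernel, and the coboundary is one such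
  value. In group terms, \<open>G\<close> is the conjugate under 1 - E of the set of all (1 + A)
  lift g with A in \<open>M\<close>.\<close>

lemma G_splits:
  obtains E where "\<And>i j. E $ i $ j \<in> m"
    "\<And>g A. R g A \<longleftrightarrow> g \<in> carrier (GL2 D) \<and> A - (act g E - E) \<in> M"
proof -
  obtain E where E: "\<And>i j. E $ i $ j \<in> m" "\<And>g. g \<in> carrier (GL2 D) \<Longrightarrow> R g (act g E - E)"
    using cocycle_coboundary by blast
  have "R g A \<longleftrightarrow> g \<in> carrier (GL2 D) \<and> A - (act g E - E) \<in> M" for g A
  proof
    assume "R g A"
    then show "g \<in> carrier (GL2 D) \<and> A - (act g E - E) \<in> M"
      using R_diff[OF _ E(2), of g A] R_carrier R_one_iff by blast
  next
    assume *: "g \<in> carrier (GL2 D) \<and> A - (act g E - E) \<in> M"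
    then show "R g A"
      using R_one_add_left[of "A - (act g E - E)" g "act g E - E"] E(2) R_one_iff by simp
  qed
  then show ?thesis
    using that E(1) by blast
qed

lemma G_iso_semidirect:
  "(GL2 UNIV)\<lparr>carrier := G\<rparr> \<cong> semidirect ((M20 m)\<lparr>carrier := M\<rparr>) (GL2 D) act"
proof -
  obtain E where E: "\<And>i j. E $ i $ j \<in> m"
    and R: "\<And>g A. R g A \<longleftrightarrow> g \<in> carrier (GL2 D) \<and> A - (act g E - E) \<in> M"
    using G_splits by blast
  let ?S = "semidirect ((M20 m)\<lparr>carrier := M\<rparr>) (GL2 D) act"
  define c where "c g = act g E - E" for g
  \<comment> \<open>Shifting by the cocycle \<open>c\<close> turns the semidirect product law into
    matrix multiplication.\<close>
  define F where "F = (\<lambda>(A, g). (mat 1 + (A + c g)) ** lift g)"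
  have R': "R g (A + c g) \<longleftrightarrow> g \<in> carrier (GL2 D) \<and> A \<in> M" for g A
    by (simp add: R c_def)
  have entries: "(A + c g) $ i $ j \<in> m" if "A \<in> M" "g \<in> carrier (GL2 D)" for A g i j
    using that R' R_carrier M20_entries by blast
  have closed: "A + act g B \<in> M" "g ** h \<in> carrier (GL2 D)"
    and F_mult: "F (A + act g B, g ** h) = F (A, g) ** F (B, h)"
    if *: "A \<in> M" "B \<in> M" "g \<in> carrier (GL2 D)" "h \<in> carrier (GL2 D)" for A B g h
  proof -
    have inv: "invertible g" "invertible h"
      using * by (auto intro: GL2_invertible)
    have eq: "(A + c g) + act g (B + c h) = (A + act g B) + c (g ** h)"
      by (simp add: c_def act_mult inv act_add act_diff)
    have "R (g ** h) ((A + c g) + act g (B + c h))"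
      using * by (intro R_mult) (simp_all add: R')
    then show "A + act g B \<in> M" "g ** h \<in> carrier (GL2 D)"
      by (simp_all add: eq R')
    show "F (A + act g B, g ** h) = F (A, g) ** F (B, h)"
      using one_plus_lift_mult[OF inv(1) entries[OF *(1,3)] entries[OF *(2,4)], of h]
      by (simp add: F_def eq)
  qed
  have residue_F: "map_matrix \<pi> (F (A, g)) = g" if "A \<in> M" "g \<in> carrier (GL2 D)" for A g
    using residue_R[of g "A + c g"] that by (simp add: F_def R')
  have "bij_betw F (M \<times> carrier (GL2 D)) G"
    unfolding bij_betw_def
  proof
    show "inj_on F (M \<times> carrier (GL2 D))"
    proof (rule inj_onI, clarify)
      fix A g B h assume *: "A \<in> M" "g \<in> carrier (GL2 D)" "B \<in> M" "h \<in> carrier (GL2 D)"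
        and eq: "F (A, g) = F (B, h)"
      have gh: "g = h"
        using residue_F[OF *(1,2)] residue_F[OF *(3,4)] eq by simp
      note inv = invertible_matrix_inv[OF GL2_invertible_lift[OF *(2)]]
      have "F (A, g) ** matrix_inv (lift g) = F (B, h) ** matrix_inv (lift g)"
        by (simp add: eq)
      then have "mat 1 + (A + c g) = mat 1 + (B + c g)"
        unfolding F_def gh[symmetric] by (simp add: matrix_mul_assoc[symmetric] inv)
      then show "A = B \<and> g = h"
        using gh by simp
    qed
    show "F ` (M \<times> carrier (GL2 D)) = G"
    proof (intro equalityI subsetI)
      fix B assume "B \<in> F ` (M \<times> carrier (GL2 D))"
      then obtain A g where "B = F (A, g)" "R g (A + c g)"
        using R' by auto
      then show "B \<in> G"
        by (simp add: F_def R_def)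
    next
      fix B assume "B \<in> G"
      then obtain g A where gA: "R g A" "B = (mat 1 + A) ** lift g"
        by (rule R_of_mem_G)
      then have "(A - c g, g) \<in> M \<times> carrier (GL2 D)" "F (A - c g, g) = B"
        using R' [of g "A - c g"] by (simp_all add: F_def)
      then show "B \<in> F ` (M \<times> carrier (GL2 D))"
        by force
    qed
  qed
  then have "F \<in> iso ?S ((GL2 UNIV)\<lparr>carrier := G\<rparr>)"
    unfolding iso_def hom_def using F_mult by (auto simp: bij_betw_def)
  then have "inv_into (carrier ?S) F \<in> iso ((GL2 UNIV)\<lparr>carrier := G\<rparr>) ?S"
    by (rule inv_into_iso) (auto simp: closed)
  then show ?thesis
    by (auto simp: is_iso_def)
qed

section \<open>Traces of the image\<close>

lemma trace_mult_lift:
  "trace (tz h e f ** lift (mat2 a b c d)) = \<iota> (a - d) * h + \<iota> c * e + \<iota> b * f"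
  by (simp add: tz_def \<iota>_diff algebra_simps)

text \<open>The coboundary contributes trace(lift g E) - trace(E lift g) = 0, so traces can be
  computed as if \<open>E\<close> were zero.\<close>

lemma trace_one_plus_coboundary:
  assumes "invertible g"
  shows "trace ((mat 1 + (A + (act g E - E))) ** lift g) = \<iota> (trace g) + trace (A ** lift g)"
proof -
  have "(mat 1 + (A + (act g E - E))) ** lift g =
      lift g + A ** lift g + (act g E ** lift g - E ** lift g)"
    by (simp add: matrix_add_rdistrib matrix_diff_left)
  also have "act g E ** lift g = lift g ** E"
    by (simp add: lift_mult_right assms)
  finally show ?thesis
    by (simp add: trace_add trace_sub trace_lift trace_mult_commute[of E])
qed

text \<open>For g with diagonal entries a and d the diagonal coordinate contributes (a - d) h.
  Replacing this by (a + d) h costs 2 d h, which lies in \<open>W\<close>, so only the trace of g is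
  left in the formula.\<close>

lemma trace_image: "trace ` G = (\<Union>s. {\<iota> s + \<iota> s * h + w |h w. h \<in> V \<and> w \<in> W})"
proof -
  obtain E where "\<And>i j. E $ i $ j \<in> m"
    and R: "\<And>g A. R g A \<longleftrightarrow> g \<in> carrier (GL2 D) \<and> A - (act g E - E) \<in> M"
    using G_splits by blast
  show ?thesis
  proof (intro equalityI subsetI)
    fix x assume "x \<in> trace ` G"
    then obtain B where B: "B \<in> G" "x = trace B"
      by blast
    obtain g A where gA: "R g A" "B = (mat 1 + A) ** lift g"
      using R_of_mem_G[OF B(1)] by blast
    obtain h e f where A: "A - (act g E - E) = tz h e f" "h \<in> V" "e \<in> W" "f \<in> W"
      using R[of g A] gA(1) unfolding M_def by blast
    have g: "invertible g"
      using R_carrier[OF gA(1)] GL2_invertible by blast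
    obtain a b c d where g_eq: "g = mat2 a b c d"
      using mat2_eta by blast
    have "x = \<iota> (trace g) + trace (tz h e f ** lift g)"
      using trace_one_plus_coboundary[OF g, of "tz h e f" E] by (simp add: B gA A(1)[symmetric])
    also have "\<dots> = \<iota> (a + d) + (\<iota> (a - d) * h + \<iota> c * e + \<iota> b * f)"
      unfolding g_eq trace_mult_lift by simp
    also have "\<dots> = \<iota> (a + d) + \<iota> (a + d) * h + (\<iota> c * e + \<iota> b * f - 2 * \<iota> d * h)"
      by (simp add: \<iota>_add \<iota>_diff algebra_simps)
    finally show "x \<in> (\<Union>s. {\<iota> s + \<iota> s * h + w |h w. h \<in> V \<and> w \<in> W})"
    proof -
      assume "x = \<iota> (a + d) + \<iota> (a + d) * h + (\<iota> c * e + \<iota> b * f - 2 * \<iota> d * h)"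
      moreover have "\<iota> c * e + \<iota> b * f - 2 * \<iota> d * h \<in> W"
        using A by (intro W_diff W_add W_mult two_V_subset_W)
      ultimately show ?thesis
        using A(2) by blast
    qed
  next
    fix x assume "x \<in> (\<Union>s. {\<iota> s + \<iota> s * h + w |h w. h \<in> V \<and> w \<in> W})"
    then obtain s h w where x: "x = \<iota> s + \<iota> s * h + w" "h \<in> V" "w \<in> W"
      by blast
    \<comment> \<open>The companion matrix has trace s and determinant 1. Its zero lower right entry
      produces s h exactly, and its lower left entry 1 picks up w.\<close>
    let ?g = "mat2 s (-1) 1 0"
    have g: "?g \<in> carrier (GL2 D)"
      by (rule mat2_in_GL2) simp
    have "tz h w 0 \<in> M"
      using x by (simp add: tz_in_M_iff)
    then have "R ?g (tz h w 0 + (act ?g E - E))"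
      by (simp add: R g)
    then have "(mat 1 + (tz h w 0 + (act ?g E - E))) ** lift ?g \<in> G"
      by (simp add: R_def)
    moreover have "trace ((mat 1 + (tz h w 0 + (act ?g E - E))) ** lift ?g) = x"
      unfolding trace_one_plus_coboundary[OF GL2_invertible[OF g]] trace_mult_lift
      by (simp add: x \<iota>_uminus)
    ultimately show "x \<in> trace ` G"
      by (rule rev_image_eqI[OF _ sym])
  qed
qed

text \<open>The residue map separates the sets \<open>S s\<close>. For nonzero s the summand from
  \<open>W\<close> is absorbed by \<open>V\<close>, leaving a bijective image of \<open>V\<close>;
  for s = 0 only \<open>W\<close> remains.\<close>

lemma card_traces:
  assumes "finite m"
  shows "card (trace ` G) = card W + (CARD('k) - 1) * card V"
proof -
  define S where "S s = {\<iota> s + \<iota> s * h + w |h w. h \<in> V \<and> w \<in> W}" for s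
  have fin: "finite V" "finite W"
    using assms V_subset W_subset finite_subset by blast+
  have S_0: "S 0 = W"
    unfolding S_def by (auto intro: V_0)
  have S_eq: "S s = (\<lambda>h. \<iota> s + \<iota> s * h) ` V" if "s \<noteq> 0" for s
  proof (intro equalityI subsetI)
    fix x assume "x \<in> S s"
    then obtain h w where x: "x = \<iota> s + \<iota> s * h + w" "h \<in> V" "w \<in> W"
      by (auto simp: S_def)
    then have "x = \<iota> s + \<iota> s * (h + \<iota> (inverse s) * w)"
      using that by (simp add: distrib_left \<iota>_inverse_cancel)
    moreover have "h + \<iota> (inverse s) * w \<in> V"
      using x W_mult W_subset_V by (blast intro: V_add)
    ultimately show "x \<in> (\<lambda>h. \<iota> s + \<iota> s * h) ` V"
      by blast
  qed (force simp: S_def)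
  have card_S: "card (S s) = card V" if "s \<noteq> 0" for s
    unfolding S_eq[OF that]
  proof (rule card_image, rule inj_onI)
    fix x y assume "\<iota> s + \<iota> s * x = \<iota> s + \<iota> s * y"
    then have "\<iota> (inverse s) * (\<iota> s * x) = \<iota> (inverse s) * (\<iota> s * y)"
      by simp
    then show "x = y"
      using that by (simp add: \<iota>_inverse_cancel)
  qed
  have \<pi>_S: "\<pi> x = s" if "x \<in> S s" for x s
    using that V_subset W_subset
    by (auto simp: S_def \<pi>_add \<pi>_mult \<pi>_\<iota> subset_iff \<pi>_eq_0_iff[THEN iffD2])
  have fin_S: "finite (S s)" for s
    using fin S_0 S_eq by (cases "s = 0") auto
  have "card (trace ` G) = card (\<Union>s\<in>UNIV. S s)"
    by (simp add: trace_image S_def)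
  also have "\<dots> = (\<Sum>s\<in>UNIV. card (S s))"
    by (rule card_UN_disjoint) (use fin_S \<pi>_S in \<open>auto, metis\<close>)
  also have "\<dots> = card (S 0) + (\<Sum>s\<in>UNIV-{0}. card (S s))"
    by (rule sum.remove) auto
  also have "(\<Sum>s\<in>UNIV-{0::'k}. card (S s)) = (CARD('k) - 1) * card V"
    by (simp add: card_S)
  finally show ?thesis
    by (simp add: S_0)
qed

text \<open>All traces lie in k + \<open>W\<close>. As this set turns out to be a subalgebra,
  generation by traces will force \<open>W\<close> to be all of m.\<close>

lemma traces_subset_of_odd:
  assumes "(2::'k) \<noteq> 0" "x \<in> trace ` G"
  shows "x - \<iota> (\<pi> x) \<in> W"
proof -
  obtain s h w where x: "x = \<iota> s + \<iota> s * h + w" "h \<in> W" "w \<in> W"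
    using assms(2) unfolding trace_image V_eq_W_of_odd[OF assms(1)] by blast
  moreover have "\<pi> x = s"
    using x W_subset by (auto simp: \<pi>_add \<pi>_mult \<pi>_\<iota> subset_iff \<pi>_eq_0_iff[THEN iffD2])
  ultimately show ?thesis
    by (simp add: W_add W_mult)
qed

text \<open>\<open>G\<close> contains one lift of each g, and a full kernel supplies all others with
  determinant in \<open>D\<close>.\<close>

lemma G_eq_GL2:
  assumes "M = carrier (M20 m)"
  shows "(GL2 UNIV)\<lparr>carrier := G\<rparr> = GL2 (\<iota> ` D)"
proof -
  have "G = carrier (GL2 (\<iota> ` D))"
  proof (intro equalityI subsetI)
    fix A assume "A \<in> G"
    then show "A \<in> carrier (GL2 (\<iota> ` D))"
      using G_inverse G_det by (auto simp: GL2_def invertible_def)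
  next
    fix B assume B: "B \<in> carrier (GL2 (\<iota> ` D))"
    then obtain \<delta> C where \<delta>: "det B = \<iota> \<delta>" "\<delta> \<in> D" and C: "B ** C = mat 1"
      by (auto simp: GL2_def invertible_def)
    have det: "det (map_matrix \<pi> B) = \<delta>"
      using arg_cong[OF \<delta>(1), of \<pi>] by (simp add: det_2 \<pi>_diff \<pi>_mult \<pi>_\<iota>)
    have "\<iota> \<delta> * det C = 1"
      using arg_cong[OF C, of det] by (simp add: det_mul \<delta>)
    from arg_cong[OF this, of \<pi>] have "\<delta> \<noteq> 0"
      by (auto simp: \<pi>_mult \<pi>_\<iota>)
    then have g: "map_matrix \<pi> B \<in> carrier (GL2 D)"
      using \<delta> by (simp add: GL2_carrier_field det)
    obtain A where A: "A \<in> carrier (M20 m)" "B = (mat 1 + A) ** lift (map_matrix \<pi> B)"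
      using lift_decomposition[OF g] \<delta> by blast
    obtain A' where A': "R (map_matrix \<pi> B) A'"
      using R_total[OF g] by blast
    then have "A - A' \<in> M"
      using assms M20_diff[OF A(1)] R_carrier by blast
    then have "R (map_matrix \<pi> B) A"
      using R_one_add_left[OF _ A', of "A - A'"] by (simp add: R_one_iff)
    then show "B \<in> G"
      using A(2) by (simp add: R_def)
  qed
  then show ?thesis
    by (simp add: GL2_def)
qed

end

lemma is_iso_sym:
  assumes "G \<cong> H" "\<And>x y. x \<in> carrier G \<Longrightarrow> y \<in> carrier G \<Longrightarrow> x \<otimes>\<^bsub>G\<^esub> y \<in> carrier G"
  shows "H \<cong> G"
  using assms(1) inv_into_iso[OF _ assms(2)] unfolding is_iso_def by blast

section \<open>The residue map of the local algebra\<close>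

context local_algebra
begin

abbreviation T :: "'t ring" where "T \<equiv> ring_of_type_algebra"

lemma T_simps [simp]:
  "carrier T = UNIV" "x \<otimes>\<^bsub>T\<^esub> y = x * y" "x \<oplus>\<^bsub>T\<^esub> y = x + y" "\<one>\<^bsub>T\<^esub> = 1" "\<zero>\<^bsub>T\<^esub> = 0"
  by (simp_all add: ring_of_type_algebra_def)

lemma mT_ideal: "ideal mT T"
  using maximal by (rule maximalideal.axioms(1))

lemma mT_0: "0 \<in> mT"
  using additive_subgroup.zero_closed[OF ideal.axioms(1)[OF mT_ideal]] by simp

lemma mT_add: "x \<in> mT \<Longrightarrow> y \<in> mT \<Longrightarrow> x + y \<in> mT"
  using additive_subgroup.a_closed[OF ideal.axioms(1)[OF mT_ideal], of x y] by simp

lemma mT_mult: "x \<in> mT \<Longrightarrow> t * x \<in> mT"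
  using ideal.I_l_closed[OF mT_ideal, of x t] by simp

lemma residue_map_ring_hom: "residue_map mT \<theta> \<in> ring_hom T (ring_of_type_algebra :: 'k ring)"
proof -
  have "\<theta> \<in> ring_hom (T Quot mT) (ring_of_type_algebra :: 'k ring)"
    using residue_iso by (simp add: ring_iso_def)
  from ring_hom_trans[OF ideal.rcos_ring_hom[OF mT_ideal] this] show ?thesis
    by (simp add: residue_map_def[abs_def] comp_def)
qed

lemma residue_map_add: "residue_map mT \<theta> (x + y) = residue_map mT \<theta> x + residue_map mT \<theta> y"
  using ring_hom_add[OF residue_map_ring_hom, of x y] by (simp add: ring_of_type_algebra_def)

lemma residue_map_mult: "residue_map mT \<theta> (x * y) = residue_map mT \<theta> x * residue_map mT \<theta> y"
  using ring_hom_mult[OF residue_map_ring_hom, of x y] by (simp add: ring_of_type_algebra_def)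

lemma residue_map_emb: "residue_map mT \<theta> (emb smul a) = a"
  using residue_iso_linear[of a] by (simp add: residue_map_def emb_def)

lemma residue_map_eq_0_iff: "residue_map mT \<theta> x = 0 \<longleftrightarrow> x \<in> mT"
proof -
  have coset: "mT +>\<^bsub>T\<^esub> y \<in> carrier (T Quot mT)" for y
    using ring_hom_closed[OF ideal.rcos_ring_hom[OF mT_ideal], of y] by simp
  have inj: "inj_on \<theta> (carrier (T Quot mT))"
    using residue_iso by (simp add: ring_iso_def bij_betw_def)
  have "residue_map mT \<theta> 0 = 0"
    using residue_map_emb[of 0] by (simp add: emb_def)
  then have "residue_map mT \<theta> x = 0 \<longleftrightarrow> mT +>\<^bsub>T\<^esub> x = mT +>\<^bsub>T\<^esub> 0"
    using inj_on_eq_iff[OF inj coset coset, of x 0] by (simp add: residue_map_def)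
  also have "mT +>\<^bsub>T\<^esub> 0 = mT"
    by (simp add: a_r_coset_def')
  also have "mT +>\<^bsub>T\<^esub> x = mT \<longleftrightarrow> x \<in> mT"
  proof
    assume "mT +>\<^bsub>T\<^esub> x = mT"
    moreover have "0 + x \<in> mT +>\<^bsub>T\<^esub> x"
      using mT_0 by (auto simp: a_r_coset_def')
    ultimately show "x \<in> mT"
      by simp
  next
    assume x: "x \<in> mT"
    have "y \<in> mT +>\<^bsub>T\<^esub> x" if y: "y \<in> mT" for y
    proof -
      have "y - x \<in> mT"
        using mT_add[OF y mT_mult[OF x, of "- 1"]] by simp
      then show ?thesis
        by (auto simp: a_r_coset_def' intro!: bexI[of _ "y - x"])
    qed
    then show "mT +>\<^bsub>T\<^esub> x = mT"
      using mT_add[OF _ x] by (auto simp: a_r_coset_def')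
  qed
  finally show ?thesis .
qed

end

section \<open>Application to the representation\<close>

context full_image_rep
begin

lemma square_zero_extension: "square_zero_extension (emb smul) mT"
proof
  show "emb smul (a + b) = emb smul a + emb smul b" for a b
    by (simp add: emb_def scale_left_distrib)
  show "emb smul (a * b) = emb smul a * emb smul b" for a b
    by (simp add: emb_mult_eq) (simp add: emb_def)
  show "emb smul 1 = 1"
    by (simp add: emb_def)
  show "x * y = 0" if "x \<in> mT" "y \<in> mT" for x y
    using ideal_prod.prod[OF that, of T] square_zero by simp
qed (use mT_0 mT_add mT_mult in auto)

lemma lifted_image:
  assumes "CARD('k) > 3" "(2::'k) \<noteq> 0 \<Longrightarrow> CARD('k) > 5"
  shows "lifted_image (emb smul) mT (residue_map mT \<theta>) D (\<rho> ` carrier \<Gamma>)"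
proof -
  interpret square_zero_extension "emb smul" mT
    by (rule square_zero_extension)
  have mult: "\<rho> (x \<otimes>\<^bsub>\<Gamma>\<^esub> y) = \<rho> x ** \<rho> y" if "x \<in> carrier \<Gamma>" "y \<in> carrier \<Gamma>" for x y
    using hom_mult[OF rep_hom that] by simp
  have inv: "invertible (\<rho> x)" if "x \<in> carrier \<Gamma>" for x
    using rep_hom that by (auto simp: hom_def GL2_def)
  have one: "\<rho> \<one>\<^bsub>\<Gamma>\<^esub> = mat 1"
  proof -
    \<comment> \<open>Membership in \<open>hom\<close> records multiplicativity only; the value at
      the identity is an invertible idempotent, hence 1.\<close>
    have "matrix_inv (\<rho> \<one>\<^bsub>\<Gamma>\<^esub>) ** (\<rho> \<one>\<^bsub>\<Gamma>\<^esub> ** \<rho> \<one>\<^bsub>\<Gamma>\<^esub>) = matrix_inv (\<rho> \<one>\<^bsub>\<Gamma>\<^esub>) ** \<rho> \<one>\<^bsub>\<Gamma>\<^esub>"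
      using mult[of "\<one>\<^bsub>\<Gamma>\<^esub>" "\<one>\<^bsub>\<Gamma>\<^esub>"] by simp
    then show ?thesis
      by (simp add: matrix_mul_assoc invertible_matrix_inv inv)
  qed
  show ?thesis
  proof (rule lifted_image.intro[OF square_zero_extension], rule lifted_image_axioms.intro)
    show "\<exists>B\<in>\<rho> ` carrier \<Gamma>. A ** B = mat 1 \<and> B ** A = mat 1" if A: "A \<in> \<rho> ` carrier \<Gamma>" for A
    proof -
      obtain x where x: "x \<in> carrier \<Gamma>" "A = \<rho> x"
        using A by blast
      have "A ** \<rho> (inv\<^bsub>\<Gamma>\<^esub> x) = mat 1" "\<rho> (inv\<^bsub>\<Gamma>\<^esub> x) ** A = mat 1"
        using mult[of x "inv\<^bsub>\<Gamma>\<^esub> x"] mult[of "inv\<^bsub>\<Gamma>\<^esub> x" x] x one by simp_all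
      then show ?thesis
        using x by blast
    qed
    show "A ** B \<in> \<rho> ` carrier \<Gamma>" if AB: "A \<in> \<rho> ` carrier \<Gamma>" "B \<in> \<rho> ` carrier \<Gamma>" for A B
    proof -
      obtain x y where "x \<in> carrier \<Gamma>" "A = \<rho> x" "y \<in> carrier \<Gamma>" "B = \<rho> y"
        using AB by blast
      then show ?thesis
        by (intro image_eqI[of _ _ "x \<otimes>\<^bsub>\<Gamma>\<^esub> y"]) (simp_all add: mult)
    qed
    show "det A \<in> emb smul ` D" if "A \<in> \<rho> ` carrier \<Gamma>" for A
      using that image_subset by (auto simp: GL2_def)
    show "map_matrix (residue_map mT \<theta>) ` \<rho> ` carrier \<Gamma> = carrier (GL2 D)"
      using residual_image by (simp add: residual_rep_def[abs_def] image_image)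
    have "residue_map mT \<theta> 1 = 1" "residue_map mT \<theta> 0 = 0"
      using residue_map_emb[of 1] residue_map_emb[of 0] by simp_all
    then have "det (residual_rep mT \<theta> \<rho> \<one>\<^bsub>\<Gamma>\<^esub>) = 1"
      by (simp add: residual_rep_def one mat_conv_mat2)
    then show "1 \<in> D"
      unfolding D_eq by (metis imageI one_closed)
  qed (use assms residue_map_add residue_map_mult residue_map_emb residue_map_eq_0_iff in auto)
qed

lemma subspaceI_emb:
  assumes "0 \<in> W" "\<And>x y. x \<in> W \<Longrightarrow> y \<in> W \<Longrightarrow> x + y \<in> W" "\<And>a x. x \<in> W \<Longrightarrow> emb smul a * x \<in> W"
  shows "subspace W"
  using assms by (simp add: subspace_def emb_mult_eq)

lemma subspace_mT: "subspace mT"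
  by (rule subspaceI_emb) (simp_all add: mT_0 mT_add mT_mult)

lemma finite_subspace:
  assumes "subspace W"
  shows "finite W" "card W = CARD('k) ^ dim W"
proof -
  obtain b where b: "bij_betw (\<lambda>c. \<Sum>i<dim W. emb smul (c i) * b i) ({..<dim W} \<rightarrow>\<^sub>E (UNIV :: 'k set)) W"
    using subspace_obtains_coordinates[OF assms] by blast
  have "finite ({..<dim W} \<rightarrow>\<^sub>E (UNIV :: 'k set))"
    by (intro finite_PiE) auto
  then show "finite W"
    using bij_betw_finite[OF b] by blast
  show "card W = CARD('k) ^ dim W"
    using bij_betw_same_card[OF b] by (simp add: card_PiE)
qed

lemma num_traces_eq: "num_traces \<Gamma> \<rho> = card (trace ` \<rho> ` carrier \<Gamma>)"
  by (simp add: num_traces_def rep_image_def)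

lemma image_of_odd:
  assumes "CARD('k) > 5" "(2::'k) \<noteq> 0"
  shows "num_traces \<Gamma> \<rho> = CARD('k) ^ (dim mT + 1)"
    and "rep_image \<Gamma> \<rho> \<cong> semidirect (M20_pow (dim mT)) (GL2 D) (conj_tuple (dim mT))"
    and "semidirect (M20_pow (dim mT)) (GL2 D) (conj_tuple (dim mT)) \<cong> GL2 (emb smul ` D)"
proof -
  interpret L: lifted_image "emb smul" mT "residue_map mT \<theta>" D "\<rho> ` carrier \<Gamma>"
    by (rule lifted_image) (use assms in auto)
  note VW = L.V_eq_W_of_odd[OF assms(2)]
  \<comment> \<open>This is k + \<open>W\<close>, written without a choice of decomposition. It is
    closed under products because \<open>W\<close> is a k-subspace and products of two elements of
    \<open>W\<close> vanish.\<close>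
  let ?S = "{x. x - emb smul (residue_map mT \<theta> x) \<in> L.W}"
  have "is_subalgebra smul ?S"
    unfolding is_subalgebra_def
  proof (intro conjI ballI allI)
    show "1 \<in> ?S"
      by simp
    fix x assume x: "x \<in> ?S"
    define x' where "x' = residue_map mT \<theta> x"
    define w where "w = x - emb smul x'"
    have w: "w \<in> L.W" and x_eq: "x = emb smul x' + w"
      using x by (simp_all add: w_def x'_def)
    show "smul a x \<in> ?S" for a
    proof -
      have "smul a x - emb smul (residue_map mT \<theta> (smul a x)) = emb smul a * w"
        by (simp add: emb_mult_eq[symmetric] residue_map_mult residue_map_emb L.\<iota>_mult w_def x'_def
          right_diff_distrib)
      then show ?thesis
        using w by (simp add: L.W_mult)
    qed
    fix y assume y: "y \<in> ?S"
    define y' where "y' = residue_map mT \<theta> y"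
    define v where "v = y - emb smul y'"
    have v: "v \<in> L.W" and y_eq: "y = emb smul y' + v"
      using y by (simp_all add: v_def y'_def)
    have "x + y - emb smul (residue_map mT \<theta> (x + y)) = w + v"
      by (simp add: residue_map_add L.\<iota>_add w_def v_def x'_def y'_def)
    then show "x + y \<in> ?S"
      using w v by (simp add: L.W_add)
    have "w * v = 0"
      using w v L.W_subset by (blast intro: L.m_square)
    then have "x * y - emb smul (x' * y') = emb smul x' * v + emb smul y' * w"
      by (simp add: x_eq y_eq L.\<iota>_mult algebra_simps)
    then show "x * y \<in> ?S"
      using w v by (simp add: residue_map_mult L.W_add L.W_mult x'_def y'_def)
  qed
  moreover have "(\<lambda>g. trace (\<rho> g)) ` carrier \<Gamma> \<subseteq> ?S"
    using L.traces_subset_of_odd[OF assms(2)] by blast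
  ultimately have S: "x \<in> ?S" for x
    using traces_generate hull_minimal[of "(\<lambda>g. trace (\<rho> g)) ` carrier \<Gamma>" ?S "is_subalgebra smul"]
    by blast
  have W: "L.W = mT"
  proof
    show "mT \<subseteq> L.W"
    proof
      fix x assume "x \<in> mT"
      then have "residue_map mT \<theta> x = 0"
        by (simp add: residue_map_eq_0_iff)
      then show "x \<in> L.W"
        using S[of x] by simp
    qed
  qed (rule L.W_subset)
  have M: "L.M = carrier (M20 mT)"
  proof
    show "carrier (M20 mT) \<subseteq> L.M"
    proof
      fix A assume "A \<in> carrier (M20 mT)"
      then obtain h e f where "A = tz h e f" "h \<in> mT" "e \<in> mT" "f \<in> mT"
        by (rule M20_carrier_obtains_tz)
      then show "A \<in> L.M"
        by (simp add: L.tz_in_M_iff VW W)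
    qed
  qed (rule L.M_subset)
  have "num_traces \<Gamma> \<rho> = CARD('k) ^ dim mT + (CARD('k) - 1) * CARD('k) ^ dim mT"
    using L.card_traces finite_subspace[OF subspace_mT] by (simp add: num_traces_eq VW W)
  also have "\<dots> = CARD('k) ^ (dim mT + 1)"
    using assms(1) by (simp add: algebra_simps diff_mult_distrib)
  finally show "num_traces \<Gamma> \<rho> = CARD('k) ^ (dim mT + 1)" .
  obtain b where "bij_betw (\<lambda>c. \<Sum>i<dim mT. emb smul (c i) * b i) ({..<dim mT} \<rightarrow>\<^sub>E UNIV) mT"
    using subspace_obtains_coordinates[OF subspace_mT] by blast
  from L.M20_pow_gmodule_iso[OF this, of D]
  have "gmodule_iso (GL2 D) (M20_pow (dim mT)) (conj_tuple (dim mT))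
      ((M20 mT)\<lparr>carrier := L.M\<rparr>) L.act"
    by (simp add: L.M_def VW W)
  then have "gmodule_iso (GL2 D) ((M20 mT)\<lparr>carrier := L.M\<rparr>) L.act
      (M20_pow (dim mT)) (conj_tuple (dim mT))"
  proof (rule gmodule_iso_sym)
    fix x y assume "x \<in> carrier (M20_pow (dim mT) :: (nat \<Rightarrow> 'k^2^2) monoid)"
      "y \<in> carrier (M20_pow (dim mT) :: (nat \<Rightarrow> 'k^2^2) monoid)"
    then show "x \<otimes>\<^bsub>M20_pow (dim mT)\<^esub> y \<in> carrier (M20_pow (dim mT))"
      by (auto simp: M20_pow_def product_group_mult PiE_iff M20_carrier trace_add)
  next
    fix g :: "'k^2^2" and x assume g: "g \<in> carrier (GL2 D)"
      and "x \<in> carrier (M20_pow (dim mT) :: (nat \<Rightarrow> 'k^2^2) monoid)"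
    then show "conj_tuple (dim mT) g x \<in> carrier (M20_pow (dim mT))"
      using L.GL2_invertible[OF g]
      by (auto simp: M20_pow_def conj_tuple_def PiE_iff M20_carrier trace_conj_mat)
  qed
  then have "semidirect ((M20 mT)\<lparr>carrier := L.M\<rparr>) (GL2 D) L.act \<cong>
      semidirect (M20_pow (dim mT)) (GL2 D) (conj_tuple (dim mT))"
    by (rule semidirect_iso) (use L.gsubmodule_M in \<open>simp add: gsubmodule_def\<close>)
  with L.G_iso_semidirect
  show iso: "rep_image \<Gamma> \<rho> \<cong> semidirect (M20_pow (dim mT)) (GL2 D) (conj_tuple (dim mT))"
    unfolding rep_image_def by (rule iso_trans)
  show "semidirect (M20_pow (dim mT)) (GL2 D) (conj_tuple (dim mT)) \<cong> GL2 (emb smul ` D)"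
    unfolding L.G_eq_GL2[OF M, symmetric]
    by (rule is_iso_sym[OF iso[unfolded rep_image_def]]) (simp add: L.G_mult)
qed

lemma image_of_even:
  assumes "CARD('k) > 3" "(2::'k) = 0" "CARD('k) = 2 ^ d"
  shows "\<exists>\<alpha> \<beta> M. describes_image smul mT \<Gamma> \<rho> D d \<alpha> \<beta> M"
proof -
  interpret L: lifted_image "emb smul" mT "residue_map mT \<theta>" D "\<rho> ` carrier \<Gamma>"
    by (rule lifted_image) (use assms in auto)
  have two: "(2::'t) = 0"
    using L.\<iota>_2 assms(2) by simp
  have double: "x + x = 0" for x :: 't
    using two by (metis mult_2 mult_zero_left)
  have sub_W: "subspace L.W"
    by (rule subspaceI_emb) (simp_all add: L.W_add L.W_mult)
  note fin = finite_subspace[OF subspace_mT] finite_subspace[OF sub_W]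
  have fin_V: "finite L.V"
    using fin(1) L.V_subset finite_subset by blast
  let ?\<alpha> = "dim L.W"
  obtain b where b: "bij_betw (\<lambda>c. \<Sum>i<?\<alpha>. emb smul (c i) * b i) ({..<?\<alpha>} \<rightarrow>\<^sub>E UNIV) L.W"
    using subspace_obtains_coordinates[OF sub_W] by blast
  \<comment> \<open>In characteristic 2 the identity matrix has trace zero and additive order
    two.\<close>
  let ?C = "{0, mat 1 :: 'k^2^2}"
  have C_neq: "(mat 1 :: 'k^2^2) \<noteq> 0"
    by (simp add: mat_conv_mat2 zero_conv_mat2)
  obtain \<beta> :: nat and v where
    v: "bij_betw (\<lambda>(w, y). w + (\<Sum>j<\<beta>. if y j = 0 then 0 else v j)) (L.W \<times> ({..<\<beta>} \<rightarrow>\<^sub>E ?C)) L.V"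
    using elementary_abelian_2_complement[OF fin_V L.W_subset_V C_neq L.V_add L.W_0 L.W_add double] by blast
  have card_V: "card L.V = CARD('k) ^ ?\<alpha> * 2 ^ \<beta>"
    using bij_betw_same_card[OF v] fin(4) C_neq
    by (simp add: card_cartesian_product card_PiE flip: numeral_2_eq_2)
  have "card L.V \<le> card mT"
    by (rule card_mono[OF fin(1) L.V_subset])
  \<comment> \<open>With q = 2^d both |V| = q^\<alpha> 2^\<beta> and |m| are powers of 2, so the
    bound on \<beta> is a comparison of exponents.\<close>
  then have "(2::nat) ^ (d * ?\<alpha> + \<beta>) \<le> 2 ^ (d * dim mT)"
    by (simp add: card_V fin(2) assms(3) power_mult power_add)
  then have \<beta>: "d * ?\<alpha> + \<beta> \<le> d * dim mT"
    by simp
  obtain Basis where "finite_dimensional_vector_space smul Basis"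
    using finite_dim by blast
  then interpret fd: finite_dimensional_vector_space smul Basis .
  have \<alpha>: "?\<alpha> \<le> dim mT"
    by (rule fd.dim_subset[OF L.W_subset])
  have emb_conj: "emb_conj smul = L.act"
    by (simp add: fun_eq_iff emb_conj_def L.act_def)
  have sub_M: "gsubmodule (GL2 D) (M20 mT) (emb_conj smul) L.M"
    unfolding emb_conj by (rule L.gsubmodule_M)
  have C: "subgroup ?C (M20 (UNIV :: 'k set))"
  proof -
    have M20: "group (M20 (UNIV :: 'k set))" "\<And>A. A \<in> carrier (M20 (UNIV :: 'k set)) \<Longrightarrow> inv\<^bsub>M20 UNIV\<^esub> A = - A"
      by (auto intro!: M20_group)
    have trace: "mat 1 \<in> carrier (M20 (UNIV :: 'k set))" "0 \<in> carrier (M20 (UNIV :: 'k set))"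
      using assms(2) by (simp_all add: mat_conv_mat2 zero_conv_mat2 M20_carrier_mat2)
    have dbl: "mat 1 + mat 1 = (0 :: 'k^2^2)"
      using assms(2) by (simp add: mat_conv_mat2 zero_conv_mat2)
    then have "- mat 1 = (mat 1 :: 'k^2^2)"
      by (simp add: eq_neg_iff_add_eq_0 minus_equation_iff)
    then show ?thesis
      using trace dbl by (intro group.subgroupI[OF M20(1)]) (auto simp: M20(2))
  qed
  have "gmodule_iso (GL2 D) (mixed_module ?\<alpha> \<beta> ?C) (mixed_act ?\<alpha> \<beta>)
      ((M20 mT)\<lparr>carrier := L.M\<rparr>) L.act"
    unfolding L.M_def by (rule L.mixed_module_gmodule_iso[OF b v assms(2)])
  then have iso: "gmodule_iso (GL2 D) ((M20 mT)\<lparr>carrier := L.M\<rparr>) (emb_conj smul)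
      (mixed_module ?\<alpha> \<beta> ?C) (mixed_act ?\<alpha> \<beta>)"
    unfolding emb_conj
  proof (rule gmodule_iso_sym)
    fix p p' assume p: "p \<in> carrier (mixed_module ?\<alpha> \<beta> ?C)" "p' \<in> carrier (mixed_module ?\<alpha> \<beta> ?C)"
    obtain x y x' y' where eq: "p = (x, y)" "p' = (x', y')"
      by (cases p, cases p')
    have "y j + y' j \<in> ?C" if "j < \<beta>" for j
    proof -
      have "y j \<in> ?C" "y' j \<in> ?C"
        using p that unfolding eq carrier_mixed_module by blast+
      then show ?thesis
        using subgroup.m_closed[OF C, of "y j" "y' j"] by simp
    qed
    moreover have "x i + x' i \<in> carrier (M20 UNIV)" if "i < ?\<alpha>" for i
    proof -
      have "x i \<in> carrier (M20 UNIV)" "x' i \<in> carrier (M20 UNIV)"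
        using p that unfolding eq carrier_mixed_module by blast+
      then show ?thesis
        by (simp add: M20_carrier trace_add)
    qed
    ultimately show "p \<otimes>\<^bsub>mixed_module ?\<alpha> \<beta> ?C\<^esub> p' \<in> carrier (mixed_module ?\<alpha> \<beta> ?C)"
      unfolding eq mult_mixed_module carrier_mixed_module by (simp add: PiE_iff)
  next
    fix g :: "'k^2^2" and p assume g: "g \<in> carrier (GL2 D)" and p: "p \<in> carrier (mixed_module ?\<alpha> \<beta> ?C)"
    note inv = L.GL2_invertible[OF g]
    obtain x y where eq: "p = (x, y)"
      by (cases p)
    have y: "y \<in> {..<\<beta>} \<rightarrow>\<^sub>E ?C" and x: "x \<in> {..<?\<alpha>} \<rightarrow>\<^sub>E carrier (M20 UNIV)"
      using p by (simp_all add: eq carrier_mixed_module)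
    have "?C \<subseteq> range mat"
      unfolding mat_0[symmetric] by blast
    then have "conj_tuple \<beta> g y = y"
      by (rule conj_tuple_scalar[OF inv y])
    moreover have "conj_mat g (x i) \<in> carrier (M20 UNIV)" if "i < ?\<alpha>" for i
    proof -
      have "x i \<in> carrier (M20 UNIV)"
        using x that by blast
      then show ?thesis
        by (simp add: M20_carrier trace_conj_mat[OF inv])
    qed
    ultimately show "mixed_act ?\<alpha> \<beta> g p \<in> carrier (mixed_module ?\<alpha> \<beta> ?C)"
      using y by (simp add: eq mixed_act_def carrier_mixed_module conj_tuple_def)
  qed
  have "num_traces \<Gamma> \<rho> = CARD('k) ^ ?\<alpha> * ((CARD('k) - 1) * 2 ^ \<beta> + 1)"
    using L.card_traces[OF fin(1)] by (simp add: num_traces_eq card_V fin(4) algebra_simps)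
  moreover have "\<beta> \<le> d * (dim mT - ?\<alpha>)"
    using \<beta> by (simp add: diff_mult_distrib2)
  moreover have "?C \<subseteq> range mat"
    unfolding mat_0[symmetric] by blast
  moreover have "card ?C = 2"
    using C_neq by simp
  moreover have "rep_image \<Gamma> \<rho> \<cong> semidirect ((M20 mT)\<lparr>carrier := L.M\<rparr>) (GL2 D) (emb_conj smul)"
    unfolding rep_image_def emb_conj by (rule L.G_iso_semidirect)
  ultimately have "describes_image smul mT \<Gamma> \<rho> D d ?\<alpha> \<beta> L.M"
    unfolding describes_image_def using \<alpha> sub_M C iso by blast
  then show ?thesis
    by blast
qed

end

lemma two_eq_0_iff_CHAR: "(2::'k::field) = 0 \<longleftrightarrow> CHAR('k) = 2"
proof -
  have "(2::'k) = 0 \<longleftrightarrow> CHAR('k) dvd 2"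
    using of_nat_eq_0_iff_char_dvd[of 2, where 'a = 'k] by simp
  also have "\<dots> \<longleftrightarrow> CHAR('k) = 2"
  proof
    assume "CHAR('k) dvd 2"
    then have "CHAR('k) = 1 \<or> CHAR('k) = 2"
      using two_is_prime_nat prime_nat_iff by blast
    moreover have "CHAR('k) \<noteq> 1"
      using of_nat_CHAR[where 'a = 'k] by force
    ultimately show "CHAR('k) = 2"
      by blast
  qed simp
  finally show ?thesis .
qed

text \<open>That t determines the module is expressed by a second representation, possibly of
  another group and over another algebra, with the same \<open>D\<close> and the same number of
  traces.\<close>

theorem theorem3p1:
  fixes smul :: "'k::{field,finite} \<Rightarrow> 't::comm_ring_1 \<Rightarrow> 't"
    and mT :: "'t set" and \<theta> :: "'t set \<Rightarrow> 'k"
    and \<Gamma> :: "'g monoid" and \<tau> :: "'g topology" and \<rho> :: "'g \<Rightarrow> 't^2^2"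
    and D :: "'k set" and p d :: nat
  assumes "CHAR('k) = p" and "CARD('k) = p ^ d" and "CARD('k) \<notin> {2, 3, 5}"
    and "full_image_rep smul mT \<theta> \<Gamma> \<tau> \<rho> D"
  shows "(p \<noteq> 2 \<longrightarrow>
            num_traces \<Gamma> \<rho> = CARD('k) ^ (vector_space.dim smul mT + 1) \<and>
            rep_image \<Gamma> \<rho> \<cong>
              semidirect (M20_pow (vector_space.dim smul mT)) (GL2 D)
                (conj_tuple (vector_space.dim smul mT)) \<and>
            semidirect (M20_pow (vector_space.dim smul mT)) (GL2 D)
                (conj_tuple (vector_space.dim smul mT)) \<cong>
              GL2 (emb smul ` D)) \<and>
         (p = 2 \<longrightarrow>
            (\<exists>\<alpha> \<beta> M. describes_image smul mT \<Gamma> \<rho> D d \<alpha> \<beta> M) \<and>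
            (\<forall>(smul' :: 'k \<Rightarrow> 't2::comm_ring_1 \<Rightarrow> 't2) mT' \<theta>' (\<Gamma>' :: 'g2 monoid) \<tau>' \<rho>'
                \<alpha> \<beta> M \<alpha>' \<beta>' M'.
               full_image_rep smul' mT' \<theta>' \<Gamma>' \<tau>' \<rho>' D \<and>
               num_traces \<Gamma>' \<rho>' = num_traces \<Gamma> \<rho> \<and>
               describes_image smul mT \<Gamma> \<rho> D d \<alpha> \<beta> M \<and>
               describes_image smul' mT' \<Gamma>' \<rho>' D d \<alpha>' \<beta>' M' \<longrightarrow>
               gmodule_iso (GL2 D) ((M20 mT)\<lparr>carrier := M\<rparr>) (emb_conj smul)
                 ((M20 mT')\<lparr>carrier := M'\<rparr>) (emb_conj smul')))"
proof -
  interpret full_image_rep smul mT \<theta> \<Gamma> \<tau> \<rho> D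
    by (rule assms(4))
  interpret square_zero_extension "emb smul" mT
    by (rule square_zero_extension)
  \<comment> \<open>This rules out q = 0 and q = 1, so excluding 2 and 3 gives q > 3.\<close>
  have "card {0, 1 :: 'k} \<le> CARD('k)"
    by (rule card_mono) auto
  then have card_gt_3: "CARD('k) > 3"
    using assms(3) by auto
  have odd: "CARD('k) > 5 \<and> (2::'k) \<noteq> 0" if "p \<noteq> 2"
  proof -
    have two: "(2::'k) \<noteq> 0"
      using that assms(1) by (simp add: two_eq_0_iff_CHAR)
    \<comment> \<open>Between 3 and 5 only q = 4 remains, and as a power of the prime p it would
      force p = 2.\<close>
    have "CARD('k) \<noteq> 4"
    proof
      assume "CARD('k) = 4"
      then have "even p"
        using assms(2) by (metis even_numeral even_power)
      then have "CHAR('k) = 2"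
        using prime_CHAR_semidom[where 'a = 'k] assms(1,2) card_gt_3
        by (metis CHAR_pos_iff finite_imp_CHAR_pos finite primes_dvd_imp_eq two_is_prime_nat)
      then show False
        using that assms(1) by simp
    qed
    then show ?thesis
      using two card_gt_3 assms(3) by auto
  qed
  have even: "(2::'k) = 0" "CARD('k) = 2 ^ d" if "p = 2"
    using that assms(1,2) by (simp_all add: two_eq_0_iff_CHAR)
  have "even CARD('k)" if "p = 2"
    using even(2)[OF that] card_gt_3 by (cases d) auto
  then have unique: "gmodule_iso (GL2 D) ((M20 mT)\<lparr>carrier := M\<rparr>) (emb_conj smul)
      ((M20 mT')\<lparr>carrier := M'\<rparr>) (emb_conj smul')"
    if "p = 2" "num_traces \<Gamma>' \<rho>' = num_traces \<Gamma> \<rho>"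
      "describes_image smul mT \<Gamma> \<rho> D d \<alpha> \<beta> M"
      "describes_image smul' mT' \<Gamma>' \<rho>' D d \<alpha>' \<beta>' M'"
    for smul' :: "'k \<Rightarrow> 't2::comm_ring_1 \<Rightarrow> 't2" and mT' \<Gamma>' \<rho>' \<alpha> \<beta> M \<alpha>' \<beta>' M'
    using describes_image_unique[OF _ _ that(3,4,2)] that(1) card_gt_3 by simp
  show ?thesis
    using image_of_odd[OF conjunct1[OF odd] conjunct2[OF odd]]
      image_of_even[OF card_gt_3 even] unique by blast
qed

end
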